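(* Let $V,W,\sigma$ be unitary operators on a Hilbert space $\mathcal{H}_0$ satisfying conditions (QW1)–(QW4) and let $e\in\pi_+\mathcal{H}_0$ be a unit vector for which condition (QWR) holds (all conditions as listed in the context). Let $\psi={}^{t}(\psi_1,\psi_2)$ be a unit vector in $\mathbb{C}^2$. Let $s,t$ be real numbers satisfying $0<s,t<1$, $s^2+t^2=1$, let $U=sV+tW$, and let $q_n(\psi;x)$ be the associated probability distribution on $\mathbb{Z}$. Then, as $n\to\infty$, the probability measures $\sum_{x\in\mathbb{Z}}q_n(\psi;x)\,\delta_{x/n}$ on $\mathbb{R}$ converge weakly to the measure $$\chi_{(-s,s)}(y)\,\frac{t\,(1+\lambda(\psi;s,t)y)}{\pi(1-y^2)\sqrt{s^2-y^2}}\,dy,$$ where $$\lambda(\psi;s,t)=|\psi_1|^2-|\psi_2|^2+2\,\mathrm{Re}(\psi_1\overline{\psi}_2)\,\frac{t}{s}.$$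
   Context: Setting. $\mathcal{H}_0$ is a complex Hilbert space with inner product $\langle\cdot,\cdot\rangle$ (linear in the first variable), and $V,W,\sigma$ are unitary operators on $\mathcal{H}_0$ such that: (QW1) $W^2=-I$; (QW2) $VW=WV^{-1}$; (QW3) $\sigma W+W\sigma=0$ and $\sigma V-V\sigma=0$; (QW4) $\sigma^*=\sigma$. Put $\pi_\pm=\frac12(I\pm\sigma)$, the projections onto the eigenspaces of $\sigma$ with eigenvalue $\pm1$. Condition (QWR): $e\in\pi_+\mathcal{H}_0$ is a unit vector with $\langle V^xe,e\rangle=0$ for every positive integer $x$. Put $X=\frac12(V+V^* )$, $Y=\frac1{2i}(V-V^* )$, $T=X+i\sigma Y$ (a unitary operator), and $\epsilon=VW$. For $x\in\mathbb{Z}$ let $e_1^x=T^xe$, $e_2^x=T^x\epsilon e$, and $e_1=e_1^0$, $e_2=e_2^0$. The vectors $e_i^x$ ($i=1,2$, $x\in\mathbb{Z}$) form an orthonormal system in $\mathcal{H}_0$, and $\mathcal{H}$, the closed linear span of them, is preserved by $V$, $W$, $\sigma$ and their inverses; hence $U=sV+tW$ is a unitary operator on $\mathcal{H}_0$ and on $\mathcal{H}$. For a unit vector $\psi={}^t(\psi_1,\psi_2)\in\mathbb{C}^2$ put $\Psi=\psi_1e_1+\psi_2e_2$ and $$q_n(\psi;x)=|\langle U^n\Psi,e_1^x\rangle|^2+|\langle U^n\Psi,e_2^x\rangle|^2,\quad x\in\mathbb{Z},$$ which is a probability distribution on $\mathbb{Z}$. $\delta_{x/n}$ is the Dirac measure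 at $x/n\in\mathbb{R}$; $\chi_{(-s,s)}$ is the indicator function of $(-s,s)$. Weak convergence of probability measures means convergence of integrals of all bounded continuous functions. *)

theory Defs
  imports "HOL-Probability.Probability"
begin

section \<open>Complex Hilbert spaces\<close>

class complex_vector = real_vector +
  fixes scaleC :: "complex \<Rightarrow> 'a \<Rightarrow> 'a" (infixr "*\<^sub>C" 75)
  assumes scaleC_add_right: "a *\<^sub>C (x + y) = a *\<^sub>C x + a *\<^sub>C y"
    and scaleC_add_left: "(a + b) *\<^sub>C x = a *\<^sub>C x + b *\<^sub>C x"
    and scaleC_scaleC: "a *\<^sub>C (b *\<^sub>C x) = (a * b) *\<^sub>C x"
    and scaleC_one: "1 *\<^sub>C x = x"
    and scaleR_scaleC: "r *\<^sub>R x = complex_of_real r *\<^sub>C x"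

text \<open>The inner product is linear in the first variable. Completeness is inherited from
  \<^class>\<open>banach\<close>, whose norm is tied to the inner product by \<open>norm_eq_sqrt_cinner\<close>.\<close>

class chilbert_space = complex_vector + banach +
  fixes cinner :: "'a \<Rightarrow> 'a \<Rightarrow> complex"
  assumes cinner_add_left: "cinner (x + y) z = cinner x z + cinner y z"
    and cinner_scaleC_left: "cinner (a *\<^sub>C x) y = a * cinner x y"
    and cinner_commute: "cinner x y = cnj (cinner y x)"
    and cinner_ge_zero: "0 \<le> Re (cinner x x)"
    and cinner_eq_zero_iff: "cinner x x = 0 \<longleftrightarrow> x = 0"
    and norm_eq_sqrt_cinner: "norm x = sqrt (Re (cinner x x))"

instantiation complex :: chilbert_space
begin

definition scaleC_complex :: "complex \<Rightarrow> complex \<Rightarrow> complex"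
  where "scaleC_complex a x = a * x"

definition cinner_complex :: "complex \<Rightarrow> complex \<Rightarrow> complex"
  where "cinner_complex x y = x * cnj y"

instance
  by standard
    (auto simp: scaleC_complex_def cinner_complex_def algebra_simps scaleR_conv_of_real
      cmod_def power2_eq_square)

end

abbreviation clinear :: "('a::complex_vector \<Rightarrow> 'b::complex_vector) \<Rightarrow> bool"
  where "clinear \<equiv> Vector_Spaces.linear scaleC scaleC"

definition unitary :: "('a::chilbert_space \<Rightarrow> 'a) \<Rightarrow> bool"
  where "unitary A \<longleftrightarrow> clinear A \<and> surj A \<and> (\<forall>x y. cinner (A x) (A y) = cinner x y)"

definition adjoint_op :: "('a::chilbert_space \<Rightarrow> 'a) \<Rightarrow> 'a \<Rightarrow> 'a"
  where "adjoint_op A = (THE B. \<forall>x y. cinner (A x) y = cinner x (B y))"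

definition zpow :: "('a \<Rightarrow> 'a) \<Rightarrow> int \<Rightarrow> 'a \<Rightarrow> 'a"
  where "zpow A k = (if 0 \<le> k then A ^^ nat k else inv A ^^ nat (- k))"

section \<open>The quantum walk\<close>

definition QW1 :: "('a::chilbert_space \<Rightarrow> 'a) \<Rightarrow> bool"
  where "QW1 W \<longleftrightarrow> (\<forall>v. W (W v) = - v)"

definition QW2 :: "('a::chilbert_space \<Rightarrow> 'a) \<Rightarrow> ('a \<Rightarrow> 'a) \<Rightarrow> bool"
  where "QW2 V W \<longleftrightarrow> (\<forall>v. V (W v) = W (inv V v))"

definition QW3 :: "('a::chilbert_space \<Rightarrow> 'a) \<Rightarrow> ('a \<Rightarrow> 'a) \<Rightarrow> ('a \<Rightarrow> 'a) \<Rightarrow> bool"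
  where "QW3 V W \<sigma> \<longleftrightarrow> (\<forall>v. \<sigma> (W v) + W (\<sigma> v) = 0) \<and> (\<forall>v. \<sigma> (V v) - V (\<sigma> v) = 0)"

definition QW4 :: "('a::chilbert_space \<Rightarrow> 'a) \<Rightarrow> bool"
  where "QW4 \<sigma> \<longleftrightarrow> adjoint_op \<sigma> = \<sigma>"

definition proj_plus :: "('a::chilbert_space \<Rightarrow> 'a) \<Rightarrow> 'a \<Rightarrow> 'a"
  where "proj_plus \<sigma> v = (1/2) *\<^sub>C (v + \<sigma> v)"

definition QWR :: "('a::chilbert_space \<Rightarrow> 'a) \<Rightarrow> ('a \<Rightarrow> 'a) \<Rightarrow> 'a \<Rightarrow> bool"
  where "QWR V \<sigma> e \<longleftrightarrow>
    e \<in> range (proj_plus \<sigma>) \<and> norm e = 1 \<and> (\<forall>x::nat. 0 < x \<longrightarrow> cinner ((V ^^ x) e) e = 0)"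

definition X_op :: "('a::chilbert_space \<Rightarrow> 'a) \<Rightarrow> 'a \<Rightarrow> 'a"
  where "X_op V v = (1/2) *\<^sub>C (V v + adjoint_op V v)"

definition Y_op :: "('a::chilbert_space \<Rightarrow> 'a) \<Rightarrow> 'a \<Rightarrow> 'a"
  where "Y_op V v = (1 / (2 * \<i>)) *\<^sub>C (V v - adjoint_op V v)"

definition T_op :: "('a::chilbert_space \<Rightarrow> 'a) \<Rightarrow> ('a \<Rightarrow> 'a) \<Rightarrow> 'a \<Rightarrow> 'a"
  where "T_op V \<sigma> v = X_op V v + \<i> *\<^sub>C \<sigma> (Y_op V v)"

definition e1 :: "('a::chilbert_space \<Rightarrow> 'a) \<Rightarrow> ('a \<Rightarrow> 'a) \<Rightarrow> 'a \<Rightarrow> int \<Rightarrow> 'a"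
  where "e1 V \<sigma> e x = zpow (T_op V \<sigma>) x e"

text \<open>Here \<open>V (W e)\<close> is the vector \<open>\<epsilon> e\<close> with \<open>\<epsilon> = V W\<close>.\<close>

definition e2 :: "('a::chilbert_space \<Rightarrow> 'a) \<Rightarrow> ('a \<Rightarrow> 'a) \<Rightarrow> ('a \<Rightarrow> 'a) \<Rightarrow> 'a \<Rightarrow> int \<Rightarrow> 'a"
  where "e2 V W \<sigma> e x = zpow (T_op V \<sigma>) x (V (W e))"

definition U_op :: "real \<Rightarrow> real \<Rightarrow> ('a::chilbert_space \<Rightarrow> 'a) \<Rightarrow> ('a \<Rightarrow> 'a) \<Rightarrow> 'a \<Rightarrow> 'a"
  where "U_op s t V W v = s *\<^sub>R V v + t *\<^sub>R W v"

definition init_state ::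
    "('a::chilbert_space \<Rightarrow> 'a) \<Rightarrow> ('a \<Rightarrow> 'a) \<Rightarrow> ('a \<Rightarrow> 'a) \<Rightarrow> 'a \<Rightarrow> complex^2 \<Rightarrow> 'a"
  where "init_state V W \<sigma> e \<psi> = (\<psi> $ 1) *\<^sub>C e1 V \<sigma> e 0 + (\<psi> $ 2) *\<^sub>C e2 V W \<sigma> e 0"

definition walk_prob ::
    "('a::chilbert_space \<Rightarrow> 'a) \<Rightarrow> ('a \<Rightarrow> 'a) \<Rightarrow> ('a \<Rightarrow> 'a) \<Rightarrow> 'a \<Rightarrow> real \<Rightarrow> real \<Rightarrow> complex^2
      \<Rightarrow> nat \<Rightarrow> int \<Rightarrow> real"
  where "walk_prob V W \<sigma> e s t \<psi> n x =
    (cmod (cinner ((U_op s t V W ^^ n) (init_state V W \<sigma> e \<psi>)) (e1 V \<sigma> e x)))\<^sup>2 +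
    (cmod (cinner ((U_op s t V W ^^ n) (init_state V W \<sigma> e \<psi>)) (e2 V W \<sigma> e x)))\<^sup>2"

section \<open>The rescaled distributions and their limit\<close>

text \<open>The measure with mass \<open>p x\<close> at the point \<open>x / n\<close> for every integer \<open>x\<close>, as the image of
  the measure on the integers with weights \<open>p\<close>. For \<open>n = 0\<close> all mass sits at \<open>0\<close>, since
  \<open>x / 0 = 0\<close>; this term does not affect the limit.\<close>

definition scaled_measure :: "(int \<Rightarrow> real) \<Rightarrow> nat \<Rightarrow> real measure"
  where "scaled_measure p n =
    distr (density (count_space UNIV) (\<lambda>x. ennreal (p x))) borel
      (\<lambda>x. real_of_int x / real n)"

definition lam :: "complex^2 \<Rightarrow> real \<Rightarrow> real \<Rightarrow> real"
  where "lam \<psi> s t =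
    (cmod (\<psi> $ 1))\<^sup>2 - (cmod (\<psi> $ 2))\<^sup>2 + 2 * Re (\<psi> $ 1 * cnj (\<psi> $ 2)) * (t / s)"

definition limit_measure :: "complex^2 \<Rightarrow> real \<Rightarrow> real \<Rightarrow> real measure"
  where "limit_measure \<psi> s t =
    density lborel (\<lambda>y. ennreal (indicator {-s<..<s} y *
      (t * (1 + lam \<psi> s t * y) / (pi * (1 - y\<^sup>2) * sqrt (s\<^sup>2 - y\<^sup>2)))))"

text \<open>Weak convergence of Borel probability measures on the real line. That all measures involved
  are probability measures is part of the notion: it rules out the default value \<open>0\<close> of integrals
  of non-integrable functions, and truncation by \<^const>\<open>ennreal\<close> of a density with negative
  values that would lose or gain mass.\<close>

definition weakly_converges :: "(nat \<Rightarrow> real measure) \<Rightarrow> real measure \<Rightarrow> bool"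
  where "weakly_converges M N \<longleftrightarrow>
    (\<forall>n. real_distribution (M n)) \<and> real_distribution N \<and>
    (\<forall>f::real \<Rightarrow> real. continuous_on UNIV f \<and> bounded (range f) \<longrightarrow>
      (\<lambda>n. \<integral>x. f x \<partial>M n) \<longlonglongrightarrow> (\<integral>x. f x \<partial>N))"

end

theory Submission imports Defs begin

text \<open>In the basis \<open>e\<^sub>1\<^sup>x = V\<^sup>x e\<close>, \<open>e\<^sub>2\<^sup>x = W V\<^sup>x\<^sup>-\<^sup>1 e\<close> the operator \<open>U\<close> acts as a two-state walk with a
  constant coin, so that the Fourier transform of the amplitudes at time \<open>n\<close> is \<open>(M k)\<^sup>n \<psi>\<close> for
  a matrix \<open>M k\<close> in SU(2) with eigenvalues \<open>exp (\<plusminus>i \<theta> k)\<close>, \<open>cos (\<theta> k) = s cos k\<close>. By Parseval the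
  characteristic function of the rescaled distribution at \<open>\<xi>\<close> is the mean over \<open>k\<close> of
  \<open>\<langle>(M (k + \<xi>/n))\<^sup>n \<psi>, (M k)\<^sup>n \<psi>\<rangle>\<close>. The phases combine to \<open>n (\<theta> (k + \<xi>/n) - \<theta> k)\<close>, which tends to
  \<open>\<xi> \<theta>' k\<close>, and the oscillating terms have coefficients that vanish in the limit, since eigenvectors
  for different eigenvalues are orthogonal. Dominated convergence, the substitution \<open>y = \<theta>' k\<close>
  and Levy's continuity theorem give the result.\<close>

section \<open>Unitary operators\<close>

lemma cinner_add_right: "cinner x (y + z) = cinner x y + cinner x (z::'a::chilbert_space)"
  by (metis cinner_commute cinner_add_left complex_cnj_add)

lemma cinner_minus_left: "cinner (- x) y = - cinner x (y::'a::chilbert_space)"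
  using cinner_scaleC_left[of "-1" x y] scaleR_scaleC[of "-1" x] by simp

lemma cinner_minus_right: "cinner x (- y) = - cinner x (y::'a::chilbert_space)"
  by (metis cinner_commute cinner_minus_left complex_cnj_minus)

lemma cinner_eqI:
  fixes y z :: "'a::chilbert_space"
  assumes "\<And>x. cinner x y = cinner x z"
  shows "y = z"
proof -
  have "cinner (y - z) (y - z) = 0"
    using assms[of "y - z"] cinner_add_right[of "y - z" y "- z"]
    by (simp add: cinner_minus_right)
  then show ?thesis by (simp add: cinner_eq_zero_iff)
qed

lemma unitary_add: "unitary A \<Longrightarrow> A (x + y) = A x + A y"
  and unitary_scaleC: "unitary A \<Longrightarrow> A (c *\<^sub>C x) = c *\<^sub>C A x"
  and unitary_cinner: "unitary A \<Longrightarrow> cinner (A x) (A y) = cinner x y"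
  by (auto simp: unitary_def Vector_Spaces.linear_iff)

lemma unitary_minus: "unitary A \<Longrightarrow> A (- x) = - A x"
  using unitary_scaleC[of A "-1" x] scaleR_scaleC[of "-1" x] scaleR_scaleC[of "-1" "A x"] by simp

lemma unitary_diff: "unitary A \<Longrightarrow> A (x - y) = A x - A y"
  using unitary_add[of A x "- y"] unitary_minus[of A y] by simp

lemma unitary_bij:
  assumes "unitary A" shows "bij A"
proof (rule bijI)
  show "inj A"
  proof (rule injI)
    fix x y assume "A x = A y"
    then have "A (x - y) = 0" using assms by (simp add: unitary_diff)
    then have "cinner (x - y) (x - y) = cinner (0::'a) 0"
      by (metis assms unitary_cinner cinner_eq_zero_iff)
    then show "x = y" by (metis cinner_eq_zero_iff right_minus_eq)
  qed
  show "surj A" using assms by (simp add: unitary_def)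
qed

lemma unitary_inv [simp]:
  assumes "unitary A"
  shows "A (inv A x) = x" "inv A (A x) = x"
  using unitary_bij[OF assms] by (simp_all add: bij_is_surj surj_f_inv_f bij_is_inj)

lemma unitary_cinner_left:
  assumes "unitary A" shows "cinner (A x) y = cinner x (inv A y)"
  by (metis assms unitary_cinner unitary_inv(1))

text \<open>\<open>adjoint_op\<close> is a definite description, so both existence and uniqueness of
  the adjoint have to be shown; uniqueness is \<open>cinner_eqI\<close>.\<close>

lemma adjoint_op_unitary:
  assumes "unitary A" shows "adjoint_op A = inv A"
  unfolding adjoint_op_def
proof (rule the_equality)
  show "\<forall>x y. cinner (A x) y = cinner x (inv A y)"
    using unitary_cinner_left[OF assms] by blast
next
  fix B assume *: "\<forall>x y. cinner (A x) y = cinner x (B y)"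
  show "B = inv A"
    by (rule ext, rule cinner_eqI) (use * unitary_cinner_left[OF assms] in metis)
qed

lemma unitary_inv_add:
  assumes "unitary A" shows "inv A (x + y) = inv A x + inv A y"
  using assms by (simp add: inv_f_eq unitary_bij bij_is_inj unitary_add)

lemma unitary_inv_diff:
  assumes "unitary A" shows "inv A (x - y) = inv A x - inv A y"
  using assms by (simp add: inv_f_eq unitary_bij bij_is_inj unitary_diff)

lemma unitary_0: "unitary A \<Longrightarrow> A 0 = 0"
  using unitary_diff[of A 0 0] by simp

lemma unitary_inv_0: "unitary A \<Longrightarrow> inv A 0 = 0"
  using unitary_inv_diff[of A 0 0] by simp

section \<open>Integer powers of a bijection\<close>

lemma zpow_0 [simp]: "zpow A 0 v = v"
  by (simp add: zpow_def)

lemma zpow_succ: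
  assumes "bij A" shows "zpow A (k + 1) v = A (zpow A k v)"
proof (cases "0 \<le> k")
  case True
  then show ?thesis by (simp add: zpow_def nat_add_distrib)
next
  case False
  then have "nat (- k) = Suc (nat (- (k + 1)))" by simp
  then have "A (zpow A k v) = (inv A ^^ nat (- (k + 1))) v"
    using False assms by (simp add: zpow_def bij_is_surj surj_f_inv_f)
  also have "\<dots> = zpow A (k + 1) v"
    using False by (cases "k = -1") (auto simp: zpow_def)
  finally show ?thesis ..
qed

lemma zpow_pred:
  assumes "bij A" shows "zpow A (k - 1) v = inv A (zpow A k v)"
  using zpow_succ[OF assms, of "k - 1" v] assms by (simp add: bij_is_inj)

text \<open>Serves to exchange \<open>T_op V \<sigma>\<close> for \<open>V\<close> along an orbit
  inside the +1 eigenspace of \<open>\<sigma>\<close>. Invariance of \<open>P\<close> under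
  \<open>inv A\<close> makes the inverses agree as well:
  \<open>B (inv A w) = A (inv A w) = w\<close>.\<close>

lemma zpow_cong_invariant:
  fixes A B :: "'a \<Rightarrow> 'a"
  assumes "bij A" "bij B" "P v"
    and "\<And>w. P w \<Longrightarrow> P (A w)" "\<And>w. P w \<Longrightarrow> P (inv A w)"
    and "\<And>w. P w \<Longrightarrow> B w = A w"
  shows "zpow B k v = zpow A k v \<and> P (zpow A k v)"
proof (induction k rule: int_induct[where k = 0])
  case base
  then show ?case using assms(3) by simp
next
  case (step1 i)
  then show ?case using assms by (simp add: zpow_succ)
next
  case (step2 i)
  have "inv B w = inv A w" if "P w" for w
    using assms that by (metis bij_inv_eq_iff)
  with step2 show ?case using assms by (simp add: zpow_pred)
qed

lemma cinner_zpow_shift: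
  assumes "unitary A"
  shows "cinner (zpow A (j + c) u) (zpow A (k + c) v) = cinner (zpow A j u) (zpow A k v)"
proof (induction c rule: int_induct[where k = 0])
  case base
  then show ?case by simp
next
  case (step1 i)
  then show ?case
    using zpow_succ[OF unitary_bij[OF assms], of "j + i"]
      zpow_succ[OF unitary_bij[OF assms], of "k + i"]
    by (simp add: add.assoc unitary_cinner[OF assms])
next
  case (step2 i)
  then show ?case
    using zpow_pred[OF unitary_bij[OF assms], of "j + i"]
      zpow_pred[OF unitary_bij[OF assms], of "k + i"]
    by (simp add: add_diff_eq) (metis assms unitary_cinner_left unitary_inv(1))
qed

section \<open>Matrix elements of the walk operator\<close>

locale qwalk =
  fixes V W \<sigma> :: "'a::chilbert_space \<Rightarrow> 'a" and e :: 'a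
  assumes unitary_V: "unitary V" and unitary_W: "unitary W" and unitary_\<sigma>: "unitary \<sigma>"
    and QW1: "QW1 W" and QW2: "QW2 V W" and QW3: "QW3 V W \<sigma>" and QW4: "QW4 \<sigma>"
    and QWR: "QWR V \<sigma> e"
begin

lemma W_W: "W (W v) = - v"
  using QW1 by (simp add: QW1_def)

lemma V_W: "V (W v) = W (inv V v)"
  using QW2 by (simp add: QW2_def)

lemma \<sigma>_W: "\<sigma> (W v) = - W (\<sigma> v)"
  using QW3 by (simp add: QW3_def eq_neg_iff_add_eq_0)

lemma \<sigma>_V: "\<sigma> (V v) = V (\<sigma> v)"
  using QW3 by (simp add: QW3_def)

lemma \<sigma>_inv_V: "\<sigma> (inv V v) = inv V (\<sigma> v)"
  by (metis \<sigma>_V unitary_V unitary_inv)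

text \<open>The adjoint of a unitary operator is its inverse, so a self-adjoint one is an
  involution.\<close>

lemma \<sigma>_\<sigma>: "\<sigma> (\<sigma> v) = v"
  using QW4 unfolding QW4_def adjoint_op_unitary[OF unitary_\<sigma>]
  by (metis unitary_\<sigma> unitary_inv(1))

lemma \<sigma>_e: "\<sigma> e = e"
proof -
  obtain w where "e = proj_plus \<sigma> w" using QWR by (auto simp: QWR_def)
  then show ?thesis
    by (simp add: proj_plus_def unitary_scaleC[OF unitary_\<sigma>] unitary_add[OF unitary_\<sigma>] \<sigma>_\<sigma> add.commute)
qed

lemma inv_V_W: "inv V (W v) = W (V v)"
  by (metis V_W unitary_V unitary_inv)

section \<open>The translation \<open>T\<close> on the eigenspaces of
  \<open>\<sigma>\<close>\<close>

lemma half_double: "(1/2) *\<^sub>C (x + x) = (x::'a)"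
proof -
  have "(1/2) *\<^sub>C (x + x) = (1/2 + 1/2) *\<^sub>C x"
    unfolding scaleC_add_right scaleC_add_left ..
  then show ?thesis by (simp add: scaleC_one)
qed

text \<open>\<open>\<sigma>\<close> commutes with \<open>V\<close> and \<open>inv V\<close>, so the
  terms regroup along \<open>v + \<sigma> v\<close> and \<open>v - \<sigma> v\<close>, twice the
  projections of \<open>v\<close>. Thus \<open>T\<close> is \<open>V\<close> on the +1 eigenspace
  and \<open>inv V\<close> on the -1 eigenspace.\<close>

lemma T_eq: "T_op V \<sigma> v = (1/2) *\<^sub>C (V (v + \<sigma> v) + inv V (v - \<sigma> v))"
proof -
  have "\<i> *\<^sub>C \<sigma> (Y_op V v) = (1/2) *\<^sub>C (V (\<sigma> v) - inv V (\<sigma> v))"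
    by (simp add: Y_op_def adjoint_op_unitary[OF unitary_V] unitary_scaleC[OF unitary_\<sigma>]
        unitary_diff[OF unitary_\<sigma>] \<sigma>_V \<sigma>_inv_V scaleC_scaleC)
  then have "T_op V \<sigma> v = (1/2) *\<^sub>C ((V v + inv V v) + (V (\<sigma> v) - inv V (\<sigma> v)))"
    by (simp only: T_op_def X_op_def adjoint_op_unitary[OF unitary_V] scaleC_add_right)
  also have "(V v + inv V v) + (V (\<sigma> v) - inv V (\<sigma> v)) = V (v + \<sigma> v) + inv V (v - \<sigma> v)"
    by (simp add: unitary_add[OF unitary_V] unitary_inv_diff[OF unitary_V])
  finally show ?thesis .
qed

lemma T_plus: "\<sigma> v = v \<Longrightarrow> T_op V \<sigma> v = V v"
  by (simp add: T_eq unitary_add[OF unitary_V] unitary_inv_0[OF unitary_V] half_double)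

lemma T_minus: "\<sigma> v = - v \<Longrightarrow> T_op V \<sigma> v = inv V v"
  by (simp add: T_eq unitary_inv_add[OF unitary_V] unitary_0[OF unitary_V] half_double)

lemma T_add: "T_op V \<sigma> (v + w) = T_op V \<sigma> v + T_op V \<sigma> w"
proof -
  have *: "v + w + \<sigma> (v + w) = (v + \<sigma> v) + (w + \<sigma> w)" "v + w - \<sigma> (v + w) = (v - \<sigma> v) + (w - \<sigma> w)"
    by (simp_all add: unitary_add[OF unitary_\<sigma>])
  have "V (v + w + \<sigma> (v + w)) + inv V (v + w - \<sigma> (v + w)) =
    (V (v + \<sigma> v) + inv V (v - \<sigma> v)) + (V (w + \<sigma> w) + inv V (w - \<sigma> w))"
    unfolding * unitary_add[OF unitary_V] unitary_inv_add[OF unitary_V] by simp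
  then show ?thesis unfolding T_eq by (simp only: scaleC_add_right)
qed

lemma eigen_decomposition:
  obtains p m where "v = p + m" "\<sigma> p = p" "\<sigma> m = - m"
proof
  have "v = (1/2) *\<^sub>C ((v + \<sigma> v) + (v - \<sigma> v))" by (simp add: half_double)
  then show "v = (1/2) *\<^sub>C (v + \<sigma> v) + (1/2) *\<^sub>C (v - \<sigma> v)"
    by (simp only: scaleC_add_right)
  show "\<sigma> ((1/2) *\<^sub>C (v + \<sigma> v)) = (1/2) *\<^sub>C (v + \<sigma> v)"
    by (simp add: unitary_scaleC[OF unitary_\<sigma>] unitary_add[OF unitary_\<sigma>] \<sigma>_\<sigma> add.commute)
  have "\<sigma> ((1/2) *\<^sub>C (v - \<sigma> v)) + (1/2) *\<^sub>C (v - \<sigma> v) = (1/2) *\<^sub>C 0"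
    unfolding unitary_scaleC[OF unitary_\<sigma>] unitary_diff[OF unitary_\<sigma>] \<sigma>_\<sigma>
    by (simp only: flip: scaleC_add_right) simp
  then show "\<sigma> ((1/2) *\<^sub>C (v - \<sigma> v)) = - ((1/2) *\<^sub>C (v - \<sigma> v))"
    using half_double[of 0] by (simp add: eq_neg_iff_add_eq_0)
qed

text \<open>The inverse \<open>?S\<close> is \<open>T\<close> with \<open>V\<close> and
  \<open>inv V\<close> exchanged; both compositions are checked on a sum of two eigenvectors of
  \<open>\<sigma>\<close>. Bijectivity is what gives the negative powers in \<open>zpow\<close>
  their meaning.\<close>

lemma bij_T: "bij (T_op V \<sigma>)"
proof (rule o_bij)
  let ?S = "\<lambda>v. inv V ((1/2) *\<^sub>C (v + \<sigma> v)) + V ((1/2) *\<^sub>C (v - \<sigma> v))"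
  have S: "?S (p + m) = inv V p + V m" if "\<sigma> p = p" "\<sigma> m = - m" for p m
  proof -
    have "p + m + \<sigma> (p + m) = p + p" "p + m - \<sigma> (p + m) = m + m"
      using that by (simp_all add: unitary_add[OF unitary_\<sigma>])
    then show ?thesis by (simp only: half_double)
  qed
  have T: "T_op V \<sigma> (p + m) = V p + inv V m" if "\<sigma> p = p" "\<sigma> m = - m" for p m
    using that by (simp add: T_add T_plus T_minus)
  have \<sigma>_V_minus: "\<sigma> (V m) = - V m" "\<sigma> (inv V m) = - inv V m" if "\<sigma> m = - m" for m
    using that unitary_minus[OF unitary_V] unitary_inv[OF unitary_V]
    by (metis \<sigma>_V, metis \<sigma>_inv_V)
  show "?S \<circ> T_op V \<sigma> = id"
  proof
    fix v
    obtain p m where v: "v = p + m" "\<sigma> p = p" "\<sigma> m = - m" by (rule eigen_decomposition)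
    show "(?S \<circ> T_op V \<sigma>) v = id v"
      unfolding comp_def v(1) T[OF v(2,3)]
      using S[of "V p" "inv V m"] v by (simp add: \<sigma>_V \<sigma>_V_minus unitary_inv[OF unitary_V])
  qed
  show "T_op V \<sigma> \<circ> ?S = id"
  proof
    fix v
    obtain p m where v: "v = p + m" "\<sigma> p = p" "\<sigma> m = - m" by (rule eigen_decomposition)
    show "(T_op V \<sigma> \<circ> ?S) v = id v"
      unfolding comp_def v(1) S[OF v(2,3)]
      using T[of "inv V p" "V m"] v by (simp add: \<sigma>_inv_V \<sigma>_V_minus unitary_inv[OF unitary_V])
  qed
qed

text \<open>The orbit of \<open>e\<close> under \<open>V\<close> stays in the +1 eigenspace of
  \<open>\<sigma>\<close>, where \<open>T\<close> is \<open>V\<close>.\<close>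

lemma e1_eq: "e1 V \<sigma> e x = zpow V x e" and \<sigma>_zpow: "\<sigma> (zpow V x e) = zpow V x e"
  using zpow_cong_invariant[OF unitary_bij[OF unitary_V] bij_T, of "\<lambda>v. \<sigma> v = v" e x]
  by (simp_all add: e1_def \<sigma>_e \<sigma>_V \<sigma>_inv_V T_plus)

text \<open>\<open>W\<close> exchanges the eigenspaces of \<open>\<sigma>\<close>, so
  \<open>T\<close> acts on these vectors as \<open>inv V\<close>, and \<open>inv V W = W V\<close>
  raises the exponent by one. The offset comes from \<open>V W e = W (inv V e)\<close>.\<close>

lemma e2_eq: "e2 V W \<sigma> e x = W (zpow V (x - 1) e)"
  unfolding e2_def
proof (induction x rule: int_induct[where k = 0])
  case base
  show ?case using zpow_pred[OF unitary_bij[OF unitary_V], of 0 e] by (simp add: V_W)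
next
  case (step1 i)
  have "T_op V \<sigma> (W (zpow V (i - 1) e)) = inv V (W (zpow V (i - 1) e))"
    by (rule T_minus) (simp add: \<sigma>_W \<sigma>_zpow)
  then show ?case
    using step1 zpow_succ[OF unitary_bij[OF unitary_V], of "i - 1" e]
    by (simp add: zpow_succ[OF bij_T] inv_V_W)
next
  case (step2 i)
  have "T_op V \<sigma> (W (zpow V (i - 1 - 1) e)) = inv V (W (zpow V (i - 1 - 1) e))"
    by (rule T_minus) (simp add: \<sigma>_W \<sigma>_zpow)
  also have "\<dots> = W (zpow V (i - 1) e)"
    using zpow_succ[OF unitary_bij[OF unitary_V], of "i - 1 - 1" e] by (simp add: inv_V_W)
  finally show ?case
    using step2 by (simp add: zpow_pred[OF bij_T] inv_f_eq[OF bij_is_inj[OF bij_T]])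
qed

text \<open>\<open>QWR\<close> treats positive powers in the first argument. Conjugate symmetry
  moves them to the second, and applying \<open>zpow V (- x)\<close> to both arguments reduces
  negative powers to positive ones.\<close>

lemma cinner_e_zpow: "cinner e (zpow V x e) = (if x = 0 then 1 else 0)"
proof -
  have pos: "cinner (zpow V x e) e = 0" if "x > 0" for x
    using QWR that by (simp add: zpow_def QWR_def)
  have "Re (cinner e e) = 1" "Im (cinner e e) = 0"
    using QWR norm_eq_sqrt_cinner[of e] cinner_commute[of e e]
    by (auto simp: QWR_def complex_eq_iff)
  then have one: "cinner e e = 1" by (simp add: complex_eq_iff)
  consider "x = 0" | "x > 0" | "x < 0" by linarith
  then show ?thesis
  proof cases
    case 2
    then show ?thesis using pos cinner_commute[of e "zpow V x e"] by simp
  next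
    case 3
    then show ?thesis using cinner_zpow_shift[OF unitary_V, of 0 "-x" e x e] pos[of "-x"] by simp
  qed (simp add: one)
qed

text \<open>\<open>W z\<close> lies in the -1 eigenspace, and eigenspaces of \<open>\<sigma>\<close>
  for different eigenvalues are orthogonal.\<close>

lemma cinner_opposite:
  assumes "\<sigma> y = y" "\<sigma> z = z"
  shows "cinner y (W z) = 0" "cinner (W z) y = 0"
proof -
  have "cinner y (W z) = - cinner y (W z)"
    using unitary_cinner[OF unitary_\<sigma>, of y "W z"] assms by (simp add: \<sigma>_W cinner_minus_right)
  then show "cinner y (W z) = 0" by simp
  then show "cinner (W z) y = 0" using cinner_commute[of "W z" y] by simp
qed

lemma cinner_init_e1:
  "cinner (init_state V W \<sigma> e \<psi>) (e1 V \<sigma> e x) = (if x = 0 then \<psi> $ 1 else 0)"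
  by (simp add: init_state_def e1_eq e2_eq cinner_add_left cinner_scaleC_left cinner_e_zpow
      cinner_opposite \<sigma>_zpow)

lemma cinner_init_e2:
  "cinner (init_state V W \<sigma> e \<psi>) (e2 V W \<sigma> e x) = (if x = 0 then \<psi> $ 2 else 0)"
  using cinner_zpow_shift[OF unitary_V, of 0 "-1" e x e]
  by (simp add: init_state_def e1_eq e2_eq cinner_add_left cinner_scaleC_left cinner_e_zpow
      cinner_opposite \<sigma>_e \<sigma>_zpow unitary_cinner[OF unitary_W])

section \<open>One step of the walk in coordinates\<close>

lemma inv_W: "inv W v = - W v"
  by (metis W_W add.inverse_inverse unitary_W unitary_inv(2) unitary_minus)

lemma cinner_U_left:
  "cinner (U_op s t V W v) y = s * cinner v (inv V y) - t * cinner v (W y)"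
  by (simp add: U_op_def cinner_add_left cinner_scaleC_left scaleR_scaleC cinner_minus_right
      unitary_cinner_left[OF unitary_V] unitary_cinner_left[OF unitary_W] inv_W)

text \<open>Once \<open>U\<close> is moved to the right argument, \<open>inv V\<close> takes
  \<open>e1\<close> at \<open>x\<close> to \<open>e1\<close> at \<open>x - 1\<close>, and
  \<open>W\<close> takes it to \<open>e2\<close> at \<open>x + 1\<close> by the offset in
  \<open>e2_eq\<close>. With \<open>cinner_U_e2\<close> this is the recursion of a two-state
  walk.\<close>

lemma cinner_U_e1:
  "cinner (U_op s t V W v) (e1 V \<sigma> e x) =
    s * cinner v (e1 V \<sigma> e (x - 1)) - t * cinner v (e2 V W \<sigma> e (x + 1))"
  by (simp add: cinner_U_left e1_eq e2_eq zpow_pred[OF unitary_bij[OF unitary_V]])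

lemma cinner_U_e2:
  "cinner (U_op s t V W v) (e2 V W \<sigma> e x) =
    t * cinner v (e1 V \<sigma> e (x - 1)) + s * cinner v (e2 V W \<sigma> e (x + 1))"
  using zpow_succ[OF unitary_bij[OF unitary_V], of "x - 1" e]
  by (simp add: cinner_U_left e1_eq e2_eq inv_V_W W_W cinner_minus_right)

end

section \<open>Trigonometric integrals\<close>

text \<open>Orthogonality of characters. The left end \<open>c\<close> is free so that the period
  can later start at \<open>- (pi/2)\<close>.\<close>

lemma has_integral_cis_period:
  "((\<lambda>k. cis (of_int m * k)) has_integral (if m = 0 then complex_of_real (2 * pi) else 0))
    {c..c + 2 * pi}"
proof (cases "m = 0")
  case True
  then show ?thesis
    using has_integral_const_real[of "1::complex" c "c + 2 * pi"]
    by (simp add: scaleR_conv_of_real)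
next
  case False
  let ?F = "\<lambda>k. - (\<i> / of_int m) * cis (of_int m * k)"
  have "(?F has_vector_derivative cis (of_int m * k)) (at k within {c..c + 2 * pi})" for k
    using False unfolding has_vector_derivative_def
    by (auto intro!: derivative_eq_intros simp: scaleR_conv_of_real field_simps)
  then have "((\<lambda>k. cis (of_int m * k)) has_integral ?F (c + 2 * pi) - ?F c) {c..c + 2 * pi}"
    by (intro fundamental_theorem_of_calculus) auto
  moreover have "cis (of_int m * (c + 2 * pi)) = cis (of_int m * c)"
  proof -
    have "cis (of_int m * (c + 2 * pi)) = cis (of_int m * c) * cis (2 * pi * of_int m)"
      by (simp add: cis_mult algebra_simps)
    then show ?thesis by (simp add: cis_multiple_2pi)
  qed
  ultimately show ?thesis using False by simp
qed

text \<open>Parseval: only diagonal terms survive the integration, and the shift by \<open>r\<close>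
  multiplies the term at \<open>x\<close> by \<open>cis (x * r)\<close>. For
  \<open>r = \<xi> / n\<close> these factors are the ones in the characteristic function of the
  rescaled position.\<close>

lemma has_integral_trig_poly_mult_cnj:
  fixes f :: "int \<Rightarrow> complex"
  assumes "finite I"
  shows "((\<lambda>k. (\<Sum>x\<in>I. f x * cis (of_int x * (k + r))) *
      cnj (\<Sum>x\<in>I. f x * cis (of_int x * k)))
    has_integral 2 * pi * (\<Sum>x\<in>I. of_real ((cmod (f x))\<^sup>2) * cis (of_int x * r))) {c..c + 2 * pi}"
proof -
  have eq: "(\<Sum>x\<in>I. f x * cis (of_int x * (k + r))) *
      cnj (\<Sum>x\<in>I. f x * cis (of_int x * k)) =
    (\<Sum>x\<in>I. \<Sum>y\<in>I. f x * cnj (f y) * cis (of_int x * r) * cis (of_int (x - y) * k))" for k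
    unfolding cnj_sum sum_product
  proof (intro sum.cong refl)
    fix x y
    have "cis (of_int x * r) * cis (of_int (x - y) * k) =
      cis (of_int x * (k + r)) * cis (- (of_int y * k))"
      by (simp add: cis_mult algebra_simps)
    then show "f x * cis (of_int x * (k + r)) * cnj (f y * cis (of_int y * k)) =
      f x * cnj (f y) * cis (of_int x * r) * cis (of_int (x - y) * k)"
      by (simp add: cis_cnj mult.assoc mult.left_commute)
  qed
  have "((\<lambda>k. \<Sum>x\<in>I. \<Sum>y\<in>I. f x * cnj (f y) * cis (of_int x * r) * cis (of_int (x - y) * k))
    has_integral (\<Sum>x\<in>I. \<Sum>y\<in>I. f x * cnj (f y) * cis (of_int x * r) *
      (if x - y = 0 then complex_of_real (2 * pi) else 0))) {c..c + 2 * pi}"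
    by (intro has_integral_sum assms has_integral_mult_right has_integral_cis_period)
  moreover have "(\<Sum>x\<in>I. \<Sum>y\<in>I. f x * cnj (f y) * cis (of_int x * r) *
      (if x - y = 0 then complex_of_real (2 * pi) else 0)) =
      2 * pi * (\<Sum>x\<in>I. of_real ((cmod (f x))\<^sup>2) * cis (of_int x * r))"
    unfolding sum_distrib_left
    by (intro sum.cong refl)
       (simp add: if_distrib[where f="\<lambda>z. _ * z"] sum.delta' assms complex_norm_square mult_ac
        cong: if_cong del: of_real_power)
  ultimately show ?thesis unfolding eq by simp
qed

text \<open>In a step of the walk the summands are translated by one while the range grows by one at
  both ends; the added terms vanish.\<close>

lemma sum_shift_supported:
  fixes f :: "int \<Rightarrow> 'b::comm_monoid_add"
  assumes supp: "\<And>x. \<bar>x\<bar> > n \<Longrightarrow> f x = 0" and "\<bar>c\<bar> \<le> m"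
  shows "(\<Sum>x\<in>{-(n + m)..n + m}. f (x + c)) = (\<Sum>x\<in>{-n..n}. f x)"
proof -
  have "(\<Sum>x\<in>{-(n + m)..n + m}. f (x + c)) = (\<Sum>x\<in>{-(n + m) + c..n + m + c}. f x)"
    by (rule sum.reindex_bij_witness[where i = "\<lambda>x. x - c" and j = "\<lambda>x. x + c"]) auto
  also have "\<dots> = (\<Sum>x\<in>{-n..n}. f x)"
    using assms by (intro sum.mono_neutral_right) auto
  finally show ?thesis .
qed

lemma integral_odd:
  fixes f :: "real \<Rightarrow> 'b::real_normed_vector"
  assumes "\<And>x. f (- x) = - f x"
  shows "integral {-c..c} f = 0"
proof -
  have "integral {-c..c} f = integral {-c..c} (\<lambda>x. f (- x))"
    using Henstock_Kurzweil_Integration.integral_reflect_real[of c "-c" f] by simp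
  also have "\<dots> = - integral {-c..c} f"
    unfolding assms by simp
  finally have "integral {-c..c} f + integral {-c..c} f = 0"
    by (metis add.left_inverse)
  then have "2 *\<^sub>R integral {-c..c} f = 0"
    unfolding scaleR_2 .
  then show ?thesis by simp
qed

text \<open>The reflection at \<open>pi/2\<close> brings the second half of the period onto the
  first, where \<open>h\<close> will be monotone. It is carried out as
  \<open>k \<mapsto> - k\<close> followed by a translation by \<open>pi\<close>.\<close>

lemma integral_full_period_fold:
  fixes f :: "real \<Rightarrow> 'b::banach"
  assumes "continuous_on UNIV f"
  shows "integral {- (pi/2)..- (pi/2) + 2 * pi} f =
    integral {- (pi/2)..pi/2} (\<lambda>k. f k + f (pi - k))"
proof -
  have f: "f integrable_on {x..y}" for x y
    using assms by (intro integrable_continuous_real) (auto intro: continuous_on_subset)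
  have f': "(\<lambda>k. f (pi - k)) integrable_on {x..y}" for x y
    by (intro integrable_continuous_real continuous_on_compose2[OF assms] continuous_intros) auto
  have "integral {pi/2..- (pi/2) + 2 * pi} f =
    integral {- (- (pi/2) + 2 * pi)..- (pi/2)} (\<lambda>k. f (- k))"
    by (rule Henstock_Kurzweil_Integration.integral_reflect_real[symmetric])
  also have "(\<lambda>k. f (- k)) = (\<lambda>k. f (pi - k)) \<circ> (+) pi"
    by (simp add: fun_eq_iff)
  also have "integral {- (- (pi/2) + 2 * pi)..- (pi/2)} \<dots> =
    integral {- (pi/2)..pi/2} (\<lambda>k. f (pi - k))"
    unfolding integral_shift_Icc_real by (rule arg_cong2[where f = integral]) auto
  finally have "integral {pi/2..- (pi/2) + 2 * pi} f = integral {- (pi/2)..pi/2} (\<lambda>k. f (pi - k))" .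
  moreover have "integral {- (pi/2)..pi/2} f + integral {pi/2..- (pi/2) + 2 * pi} f =
    integral {- (pi/2)..- (pi/2) + 2 * pi} f"
    by (rule Henstock_Kurzweil_Integration.integral_combine[OF _ _ f]) (use pi_gt_zero in linarith)+
  ultimately show ?thesis
    by (simp add: Henstock_Kurzweil_Integration.integral_add f f')
qed

section \<open>Powers of the coin matrix\<close>

text \<open>\<open>(x, y)\<close> is the image of \<open>(p, q)\<close> under the skew-Hermitian
  matrix \<open>K\<close> with rows \<open>(\<i> a, - t cnj z)\<close> and
  \<open>(t z, - \<i> a)\<close>, and \<open>K^2 = - (a^2 + t^2)\<close>. For
  \<open>a = s * sin k\<close> and \<open>z = cis k\<close> this \<open>K\<close> is
  \<open>D k\<close> times \<open>J\<close>.\<close>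

lemma coin_identities:
  fixes a t :: real and z p q :: complex
  assumes "z * cnj z = 1"
  defines "x \<equiv> \<i> * of_real a * p - of_real t * cnj z * q"
    and "y \<equiv> of_real t * z * p - \<i> * of_real a * q"
  shows "x * cnj x + y * cnj y = of_real (a\<^sup>2 + t\<^sup>2) * (p * cnj p + q * cnj q)"
    and "x * cnj p + y * cnj q =
      \<i> * of_real (a * ((cmod p)\<^sup>2 - (cmod q)\<^sup>2) + 2 * t * Im (z * (p * cnj q)))"
    and "\<i> * of_real a * x - of_real t * cnj z * y = - (of_real (a\<^sup>2 + t\<^sup>2) * p)"
    and "of_real t * z * x - \<i> * of_real a * y = - (of_real (a\<^sup>2 + t\<^sup>2) * q)"
proof -
  \<comment> \<open>With \<open>z * cnj z\<close> inserted, three of the claims become polynomial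
    identities.\<close>
  have z: "of_real (a\<^sup>2 + t\<^sup>2) = (of_real a)\<^sup>2 + (of_real t)\<^sup>2 * (z * cnj z)"
    by (simp add: assms(1))
  show "x * cnj x + y * cnj y = of_real (a\<^sup>2 + t\<^sup>2) * (p * cnj p + q * cnj q)"
    unfolding z by (simp add: x_def y_def power2_eq_square algebra_simps)
  show "\<i> * of_real a * x - of_real t * cnj z * y = - (of_real (a\<^sup>2 + t\<^sup>2) * p)"
    unfolding z by (simp add: x_def y_def power2_eq_square algebra_simps)
  show "of_real t * z * x - \<i> * of_real a * y = - (of_real (a\<^sup>2 + t\<^sup>2) * q)"
    unfolding z by (simp add: x_def y_def power2_eq_square algebra_simps)
  show "x * cnj p + y * cnj q =
      \<i> * of_real (a * ((cmod p)\<^sup>2 - (cmod q)\<^sup>2) + 2 * t * Im (z * (p * cnj q)))"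
    unfolding x_def y_def cmod_power2 by (simp add: complex_eq_iff power2_eq_square algebra_simps)
qed

locale coin =
  fixes s t :: real and p q :: complex
  assumes s_pos: "0 < s" and t_pos: "0 < t" and s2_t2: "s\<^sup>2 + t\<^sup>2 = 1"
    and norm_pq: "(cmod p)\<^sup>2 + (cmod q)\<^sup>2 = 1"
begin

text \<open>The Fourier transform of one step of the walk is multiplication by a matrix \<open>M k\<close> of
  determinant \<open>1\<close> and trace \<open>2 s cos k\<close>. With \<open>J = (M - cos \<theta>) / sin \<theta>\<close> one has \<open>J\<^sup>2 = - 1\<close>,
  hence \<open>M\<^sup>n = cos (n \<theta>) + sin (n \<theta>) J\<close>. Below, \<open>D = sin \<theta>\<close>, \<open>h = \<theta>'\<close>, \<open>(u, v) = J (p, q)\<close>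
  and \<open>\<i> j = \<langle>J (p, q), (p, q)\<rangle>\<close>.\<close>

definition D :: "real \<Rightarrow> real" where "D k = sqrt (1 - s\<^sup>2 * (cos k)\<^sup>2)"
definition \<theta> :: "real \<Rightarrow> real" where "\<theta> k = arccos (s * cos k)"
definition h :: "real \<Rightarrow> real" where "h k = s * sin k / D k"
definition u :: "real \<Rightarrow> complex"
  where "u k = (\<i> * of_real (s * sin k) * p - of_real t * cnj (cis k) * q) / of_real (D k)"
definition v :: "real \<Rightarrow> complex"
  where "v k = (of_real t * cis k * p - \<i> * of_real (s * sin k) * q) / of_real (D k)"
definition \<Lambda> :: real
  where "\<Lambda> = (cmod p)\<^sup>2 - (cmod q)\<^sup>2 + 2 * Re (p * cnj q) * (t / s)"
definition j :: "real \<Rightarrow> real"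
  where "j k = \<Lambda> * h k + 2 * t * Im (p * cnj q) * cos k / D k"

lemma s_less_1: "s < 1"
proof -
  have "0 < s\<^sup>2" "0 < t\<^sup>2" using s_pos t_pos by simp_all
  then have "s\<^sup>2 < 1" using s2_t2 by linarith
  then show ?thesis by (simp add: abs_square_less_1)
qed

text \<open>As \<open>(cos k)^2 \<le> 1\<close>, the radicand is at least
  \<open>1 - s^2 = t^2\<close>; hence \<open>D\<close> stays away from zero.\<close>

lemma D2: "(D k)\<^sup>2 = 1 - s\<^sup>2 * (cos k)\<^sup>2" and D_pos: "0 < D k"
proof -
  have "s\<^sup>2 * (cos k)\<^sup>2 \<le> s\<^sup>2 * 1"
    by (intro mult_left_mono) (auto simp: abs_square_le_1)
  then have *: "t\<^sup>2 \<le> 1 - s\<^sup>2 * (cos k)\<^sup>2" using s2_t2 by simp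
  moreover have "0 \<le> t\<^sup>2" by simp
  ultimately have "0 \<le> 1 - s\<^sup>2 * (cos k)\<^sup>2" by linarith
  then show "(D k)\<^sup>2 = 1 - s\<^sup>2 * (cos k)\<^sup>2"
    unfolding D_def by (rule real_sqrt_pow2)
  have "t \<le> D k" unfolding D_def using * by (rule real_le_rsqrt)
  then show "0 < D k" using t_pos by simp
qed

lemma D_nz [simp]: "D k \<noteq> 0"
  using D_pos[of k] by simp

lemma D2': "(D k)\<^sup>2 = s\<^sup>2 * (sin k)\<^sup>2 + t\<^sup>2"
proof -
  have "(cos k)\<^sup>2 = 1 - (sin k)\<^sup>2" by (simp add: cos_squared_eq)
  then show ?thesis using s2_t2 by (simp add: D2 right_diff_distrib)
qed

lemma abs_s_cos: "\<bar>s * cos k\<bar> < 1"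
proof -
  have "s * \<bar>cos k\<bar> \<le> s * 1" using s_pos by (intro mult_left_mono) auto
  moreover have "\<bar>s * cos k\<bar> = s * \<bar>cos k\<bar>" using s_pos by (simp add: abs_mult)
  ultimately show ?thesis using s_less_1 by linarith
qed

lemma cos_\<theta>: "cos (\<theta> k) = s * cos k"
  unfolding \<theta>_def by (rule cos_arccos_abs[OF less_imp_le[OF abs_s_cos]])

lemma sin_\<theta>: "sin (\<theta> k) = D k"
  unfolding \<theta>_def sin_arccos_abs[OF less_imp_le[OF abs_s_cos]] D_def power_mult_distrib ..

lemma has_real_derivative_\<theta>: "(\<theta> has_real_derivative h k) (at k)"
proof -
  have "-1 < s * cos k" "s * cos k < 1" using abs_s_cos[of k] by linarith+
  from DERIV_arccos[OF this]
  have "(arccos has_real_derivative inverse (- D k)) (at (s * cos k))"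
    by (simp add: D_def power_mult_distrib)
  moreover have "((\<lambda>k. s * cos k) has_real_derivative s * (- sin k)) (at k)"
    by (auto intro!: derivative_eq_intros)
  ultimately have "((\<lambda>k. arccos (s * cos k)) has_real_derivative
    inverse (- D k) * (s * (- sin k))) (at k)"
    by (rule DERIV_chain2)
  then show ?thesis by (simp add: \<theta>_def[abs_def] h_def field_simps)
qed

lemma continuous_on_D [continuous_intros]: "continuous_on A D"
  unfolding D_def by (intro continuous_intros)

lemma continuous_on_h [continuous_intros]: "continuous_on A h"
  unfolding h_def by (intro continuous_intros) auto

lemma continuous_on_j [continuous_intros]: "continuous_on A j"
  unfolding j_def by (intro continuous_intros) auto

lemma continuous_on_u [continuous_intros]: "continuous_on A u"
  unfolding u_def by (intro continuous_intros) auto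

lemma continuous_on_v [continuous_intros]: "continuous_on A v"
  unfolding v_def by (intro continuous_intros) auto

lemma cis_cnj_cis: "cis k * cnj (cis k) = 1"
  by (simp add: cis_cnj cis_mult)

lemma D_D: "of_real ((s * sin k)\<^sup>2 + t\<^sup>2) = complex_of_real (D k) * complex_of_real (D k)"
  by (simp only: power_mult_distrib D2'[symmetric] power2_eq_square[of "D k"] of_real_mult)

lemma of_real_D_nz: "complex_of_real (D k) \<noteq> 0"
  by simp

lemma pq_pq: "p * cnj p + q * cnj q = 1"
  using norm_pq by (simp only: complex_norm_square[symmetric] of_real_add[symmetric]) simp

lemma norm_uv: "u k * cnj (u k) + v k * cnj (v k) = 1"
  using coin_identities(1)[OF cis_cnj_cis[of k], where a = "s * sin k" and p = p and t = t and q = q]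
    of_real_D_nz[of k]
  unfolding pq_pq D_D
  by (simp only: u_def v_def complex_cnj_divide complex_cnj_complex_of_real times_divide_times_eq
      add_divide_distrib[symmetric]) simp

lemma uv_pq: "u k * cnj p + v k * cnj q = \<i> * of_real (j k)"
proof -
  \<comment> \<open>The sine part of \<open>Im (cis k * (p * cnj q))\<close> carries the real part
    of \<open>p * cnj q\<close> and joins the first term to form \<open>\<Lambda>\<close>; the
    cosine part is the second term of \<open>j\<close>.\<close>
  have *: "s * sin k * ((cmod p)\<^sup>2 - (cmod q)\<^sup>2) + 2 * t * Im (cis k * (p * cnj q)) = j k * D k"
    using s_pos by (simp add: j_def \<Lambda>_def h_def field_simps)
  have "u k * cnj p + v k * cnj q = (\<i> * of_real (j k * D k)) / of_real (D k)"
    unfolding *[symmetric] coin_identities(2)[OF cis_cnj_cis, symmetric]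
    by (simp only: u_def v_def times_divide_eq_left add_divide_distrib)
  then show ?thesis by simp
qed

lemma pq_uv: "p * cnj (u k) + q * cnj (v k) = - \<i> * of_real (j k)"
  using arg_cong[OF uv_pq[of k], of cnj] by (simp add: mult.commute)

lemma norm_uv_real: "(cmod (u k))\<^sup>2 + (cmod (v k))\<^sup>2 = 1"
proof -
  have "complex_of_real ((cmod (u k))\<^sup>2 + (cmod (v k))\<^sup>2) = 1"
    using norm_uv[of k] by (simp only: of_real_add complex_norm_square)
  then show ?thesis by (simp only: of_real_eq_1_iff)
qed

lemma cmod_uv_le: "cmod (u k) \<le> 1" "cmod (v k) \<le> 1" and cmod_pq_le: "cmod p \<le> 1" "cmod q \<le> 1"
proof -
  have "(cmod (u k))\<^sup>2 \<le> 1" "(cmod (v k))\<^sup>2 \<le> 1"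
    using norm_uv_real[of k] zero_le_power2[of "cmod (u k)"] zero_le_power2[of "cmod (v k)"] by linarith+
  then show "cmod (u k) \<le> 1" "cmod (v k) \<le> 1" by (simp_all add: abs_square_le_1)
  have "(cmod p)\<^sup>2 \<le> 1" "(cmod q)\<^sup>2 \<le> 1"
    using norm_pq zero_le_power2[of "cmod p"] zero_le_power2[of "cmod q"] by linarith+
  then show "cmod p \<le> 1" "cmod q \<le> 1" by (simp_all add: abs_square_le_1)
qed

section \<open>Closed form of the Fourier amplitudes\<close>

definition ampA :: "nat \<Rightarrow> real \<Rightarrow> complex"
  where "ampA n k = cos (n * \<theta> k) * p + sin (n * \<theta> k) * u k"
definition ampB :: "nat \<Rightarrow> real \<Rightarrow> complex"
  where "ampB n k = cos (n * \<theta> k) * q + sin (n * \<theta> k) * v k"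

text \<open>These are the diagonal entries of \<open>M k\<close>: the common real part is
  \<open>cos (\<theta> k)\<close>, the imaginary part belongs to
  \<open>sin (\<theta> k) J\<close>.\<close>

lemma s_cis:
  "complex_of_real s * cis k = of_real (cos (\<theta> k)) + \<i> * of_real (s * sin k)"
  "complex_of_real s * cnj (cis k) = of_real (cos (\<theta> k)) - \<i> * of_real (s * sin k)"
  unfolding cos_\<theta> complex_eq_iff by simp_all

text \<open>The decomposition \<open>M = cos \<theta> + sin \<theta> J\<close> applied to
  \<open>(p, q)\<close>.\<close>

lemma M_pq:
  "of_real s * cis k * p - of_real t * cnj (cis k) * q =
      of_real (cos (\<theta> k)) * p + of_real (sin (\<theta> k)) * u k"
  "of_real t * cis k * p + of_real s * cnj (cis k) * q =
      of_real (cos (\<theta> k)) * q + of_real (sin (\<theta> k)) * v k"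
proof -
  have Du: "of_real (sin (\<theta> k)) * u k = \<i> * of_real (s * sin k) * p - of_real t * cnj (cis k) * q"
    and Dv: "of_real (sin (\<theta> k)) * v k = of_real t * cis k * p - \<i> * of_real (s * sin k) * q"
    unfolding sin_\<theta> u_def v_def using of_real_D_nz[of k]
    by (simp_all only: nonzero_mult_div_cancel_left times_divide_eq_right not_False_eq_True)
  show "of_real s * cis k * p - of_real t * cnj (cis k) * q =
      of_real (cos (\<theta> k)) * p + of_real (sin (\<theta> k)) * u k"
    unfolding Du s_cis(1) by (simp only: ring_distribs) simp
  show "of_real t * cis k * p + of_real s * cnj (cis k) * q =
      of_real (cos (\<theta> k)) * q + of_real (sin (\<theta> k)) * v k"
    unfolding Dv s_cis(2) by (simp only: ring_distribs) simp
qed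

text \<open>The same decomposition applied to \<open>(u, v) = J (p, q)\<close>; the minus sign is
  \<open>J^2 = - 1\<close>.\<close>

lemma M_uv:
  "of_real s * cis k * u k - of_real t * cnj (cis k) * v k =
      of_real (cos (\<theta> k)) * u k - of_real (sin (\<theta> k)) * p"
  "of_real t * cis k * u k + of_real s * cnj (cis k) * v k =
      of_real (cos (\<theta> k)) * v k - of_real (sin (\<theta> k)) * q"
proof -
  have "\<i> * of_real (s * sin k) * u k - of_real t * cnj (cis k) * v k =
    - (of_real (D k) * of_real (D k) * p) / of_real (D k)"
    unfolding u_def v_def times_divide_eq_right diff_divide_distrib[symmetric] D_D[symmetric]
      coin_identities(3)[OF cis_cnj_cis] ..
  then have "\<i> * of_real (s * sin k) * u k - of_real t * cnj (cis k) * v k = - (of_real (D k) * p)"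
    by simp
  then show "of_real s * cis k * u k - of_real t * cnj (cis k) * v k =
      of_real (cos (\<theta> k)) * u k - of_real (sin (\<theta> k)) * p"
    unfolding s_cis(1) sin_\<theta> by (simp only: ring_distribs) simp
  have "of_real t * cis k * u k - \<i> * of_real (s * sin k) * v k =
    - (of_real (D k) * of_real (D k) * q) / of_real (D k)"
    unfolding u_def v_def times_divide_eq_right diff_divide_distrib[symmetric] D_D[symmetric]
      coin_identities(4)[OF cis_cnj_cis] ..
  then have "of_real t * cis k * u k - \<i> * of_real (s * sin k) * v k = - (of_real (D k) * q)"
    by simp
  then show "of_real t * cis k * u k + of_real s * cnj (cis k) * v k =
      of_real (cos (\<theta> k)) * v k - of_real (sin (\<theta> k)) * q"
    unfolding s_cis(2) sin_\<theta> by (simp only: ring_distribs) simp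
qed

text \<open>By \<open>M_pq\<close> and \<open>M_uv\<close>, \<open>M\<close> rotates the pair
  \<open>(p, q)\<close>, \<open>(u, v)\<close> by the angle \<open>\<theta> k\<close>, so the
  addition formulas for cosine and sine give the step from \<open>n\<close> to
  \<open>n + 1\<close>.\<close>

lemma amp_Suc:
  "ampA (Suc n) k = s * cis k * ampA n k - t * cnj (cis k) * ampB n k"
  "ampB (Suc n) k = t * cis k * ampA n k + s * cnj (cis k) * ampB n k"
proof -
  let ?C = "complex_of_real (cos (n * \<theta> k))" and ?S = "complex_of_real (sin (n * \<theta> k))"
  have cs: "complex_of_real (cos (Suc n * \<theta> k)) = ?C * cos (\<theta> k) - ?S * sin (\<theta> k)"
    "complex_of_real (sin (Suc n * \<theta> k)) = ?S * cos (\<theta> k) + ?C * sin (\<theta> k)"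
    by (simp_all add: distrib_right cos_add sin_add algebra_simps)
  have "s * cis k * ampA n k - t * cnj (cis k) * ampB n k =
    ?C * (s * cis k * p - t * cnj (cis k) * q) + ?S * (s * cis k * u k - t * cnj (cis k) * v k)"
    by (simp add: ampA_def ampB_def algebra_simps)
  then show "ampA (Suc n) k = s * cis k * ampA n k - t * cnj (cis k) * ampB n k"
    unfolding M_pq M_uv by (simp only: ampA_def cs) (simp add: algebra_simps)
  have "t * cis k * ampA n k + s * cnj (cis k) * ampB n k =
    ?C * (t * cis k * p + s * cnj (cis k) * q) + ?S * (t * cis k * u k + s * cnj (cis k) * v k)"
    by (simp add: ampA_def ampB_def algebra_simps)
  then show "ampB (Suc n) k = t * cis k * ampA n k + s * cnj (cis k) * ampB n k"
    unfolding M_pq M_uv by (simp only: ampB_def cs) (simp add: algebra_simps)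
qed

text \<open>Crude, but uniform in \<open>n\<close> and \<open>k\<close>: it controls the remainder
  \<open>R\<close> below and supplies the majorant for dominated convergence.\<close>

lemma amp_bound: "cmod (ampA n k) \<le> 2" "cmod (ampB n k) \<le> 2"
proof -
  have *: "cmod (of_real (cos x) * z + of_real (sin x) * w) \<le> 2"
    if "cmod z \<le> 1" "cmod w \<le> 1" for x :: real and z w
  proof -
    have "cmod (of_real (cos x) * z + of_real (sin x) * w) \<le> \<bar>cos x\<bar> * cmod z + \<bar>sin x\<bar> * cmod w"
      by (rule order_trans[OF norm_triangle_ineq]) (simp add: norm_mult)
    also have "\<dots> \<le> 1 * 1 + 1 * 1" using that by (intro add_mono mult_mono) auto
    finally show ?thesis by simp
  qed
  show "cmod (ampA n k) \<le> 2" "cmod (ampB n k) \<le> 2"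
    unfolding ampA_def ampB_def using cmod_uv_le cmod_pq_le by (auto intro!: *)
qed

section \<open>Continuity and asymptotics of the amplitudes\<close>

lemma continuous_on_\<theta> [continuous_intros]: "continuous_on A \<theta>"
  using has_real_derivative_\<theta> by (meson DERIV_continuous continuous_at_imp_continuous_on)

lemma continuous_on_amp [continuous_intros]:
  "continuous_on A f \<Longrightarrow> continuous_on A (\<lambda>x. ampA n (f x))"
  "continuous_on A f \<Longrightarrow> continuous_on A (\<lambda>x. ampB n (f x))"
proof -
  have "continuous_on UNIV (ampA n)" "continuous_on UNIV (ampB n)"
    unfolding ampA_def ampB_def by (intro continuous_intros)+
  then show "continuous_on A f \<Longrightarrow> continuous_on A (\<lambda>x. ampA n (f x))"
    "continuous_on A f \<Longrightarrow> continuous_on A (\<lambda>x. ampB n (f x))"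
    by (auto intro: continuous_on_compose2)
qed

text \<open>This is \<open>\<xi>\<close> times the difference quotient of \<open>\<theta>\<close>
  with increment \<open>\<xi> / n\<close>; for \<open>\<xi> = 0\<close> the quotient
  degenerates.\<close>

lemma phase_increment_tendsto:
  "(\<lambda>n. real n * \<theta> (k + \<xi> / n) - real n * \<theta> k) \<longlonglongrightarrow> \<xi> * h k"
proof (cases "\<xi> = 0")
  case False
  have "filterlim (\<lambda>n. \<xi> / real n) (at 0) sequentially"
    unfolding filterlim_at using False
    by (auto intro!: tendsto_divide_0[OF tendsto_const] filterlim_real_sequentially
        filterlim_at_top_imp_at_infinity eventually_gt_at_top[THEN eventually_mono])
  with has_real_derivative_\<theta>[of k, unfolded DERIV_def]
  have "(\<lambda>n. (\<theta> (k + \<xi> / real n) - \<theta> k) / (\<xi> / real n)) \<longlonglongrightarrow> h k"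
    by (rule filterlim_compose)
  then have "(\<lambda>n. \<xi> * ((\<theta> (k + \<xi> / real n) - \<theta> k) / (\<xi> / real n))) \<longlonglongrightarrow> \<xi> * h k"
    by (intro tendsto_intros)
  \<comment> \<open>At \<open>n = 0\<close> both sides are 0, since
    \<open>\<xi> / 0 = 0\<close>.\<close>
  moreover have "\<xi> * ((\<theta> (k + \<xi> / real n) - \<theta> k) / (\<xi> / real n)) =
      real n * \<theta> (k + \<xi> / n) - real n * \<theta> k" for n
    using False by (simp add: right_diff_distrib[symmetric] mult.commute)
  ultimately show ?thesis by simp
qed simp

lemma amp_product_tendsto:
  "(\<lambda>n. ampA n (k + \<xi> / n) * cnj (ampA n k) + ampB n (k + \<xi> / n) * cnj (ampB n k))
    \<longlonglongrightarrow> of_real (cos (\<xi> * h k)) + \<i> * of_real (sin (\<xi> * h k)) * of_real (j k)"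
proof -
  define S where "S = (\<lambda>n x. complex_of_real (sin (real n * \<theta> x)))"
  define k' where "k' = (\<lambda>n. k + \<xi> / real n)"
  define \<Delta> where "\<Delta> = (\<lambda>n. real n * \<theta> (k' n) - real n * \<theta> k)"
  \<comment> \<open>\<open>R\<close> is the cost of replacing \<open>J\<close> at
    \<open>k' n\<close> by \<open>J\<close> at \<open>k\<close>. The other inner products are all
    taken at \<open>k\<close>, namely 1 and plus or minus \<open>\<i> * j k\<close>, so the
    trigonometric factors combine to functions of \<open>\<Delta> n\<close>.\<close>
  define R where "R = (\<lambda>n. S n (k' n) * (u (k' n) - u k) * cnj (ampA n k)
      + S n (k' n) * (v (k' n) - v k) * cnj (ampB n k))"
  have expand: "(c' * p + s' * u') * cnj (of_real c * p + of_real s * u0)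
      + (c' * q + s' * v') * cnj (of_real c * q + of_real s * v0) =
      c' * of_real c * (p * cnj p + q * cnj q) + s' * of_real c * (u0 * cnj p + v0 * cnj q)
      + c' * of_real s * (p * cnj u0 + q * cnj v0) + s' * of_real s * (u0 * cnj u0 + v0 * cnj v0)
      + (s' * (u' - u0) * cnj (of_real c * p + of_real s * u0)
        + s' * (v' - v0) * cnj (of_real c * q + of_real s * v0))"
    for c' s' u' v' u0 v0 :: complex and c s :: real
    by (simp add: algebra_simps)
  have eq: "ampA n (k' n) * cnj (ampA n k) + ampB n (k' n) * cnj (ampB n k) =
     of_real (cos (\<Delta> n)) + \<i> * of_real (sin (\<Delta> n)) * of_real (j k) + R n" for n
    unfolding R_def ampA_def ampB_def expand pq_pq uv_pq pq_uv norm_uv \<Delta>_def cos_diff sin_diff S_def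
    by (simp add: algebra_simps)
  have k': "k' \<longlonglongrightarrow> k"
    unfolding k'_def using tendsto_add[OF tendsto_const[of k] lim_const_over_n[of \<xi>]] by simp
  have bnd: "cmod (S n x) \<le> 1" for n x by (simp add: S_def)
  have "isCont u k" "isCont v k"
    using continuous_on_u[of UNIV] continuous_on_v[of UNIV]
    by (simp_all add: continuous_on_eq_continuous_at)
  from this[THEN isCont_tendsto_compose, OF k']
  have uv: "(\<lambda>n. u (k' n) - u k) \<longlonglongrightarrow> 0" "(\<lambda>n. v (k' n) - v k) \<longlonglongrightarrow> 0"
    by (simp_all only: LIM_zero_iff)
  have bound: "cmod (R n) \<le> 2 * cmod (u (k' n) - u k) + 2 * cmod (v (k' n) - v k)" for n
  proof -
    have "cmod (R n) \<le> cmod (S n (k' n)) * cmod (u (k' n) - u k) * cmod (ampA n k)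
      + cmod (S n (k' n)) * cmod (v (k' n) - v k) * cmod (ampB n k)"
      unfolding R_def by (rule order_trans[OF norm_triangle_ineq]) (simp add: norm_mult)
    also have "\<dots> \<le> 1 * cmod (u (k' n) - u k) * 2 + 1 * cmod (v (k' n) - v k) * 2"
      by (intro add_mono mult_mono bnd amp_bound) auto
    finally show ?thesis by simp
  qed
  have "(\<lambda>n. 2 * cmod (u (k' n) - u k) + 2 * cmod (v (k' n) - v k)) \<longlonglongrightarrow> 2 * cmod 0 + 2 * cmod 0"
    by (intro tendsto_intros uv)
  then have "(\<lambda>n. 2 * cmod (u (k' n) - u k) + 2 * cmod (v (k' n) - v k)) \<longlonglongrightarrow> 0"
    by simp
  with always_eventually[OF allI[OF bound]] have R: "R \<longlonglongrightarrow> 0"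
    by (rule Lim_null_comparison)
  have "\<Delta> \<longlonglongrightarrow> \<xi> * h k" unfolding \<Delta>_def k'_def by (rule phase_increment_tendsto)
  then have "(\<lambda>n. of_real (cos (\<Delta> n)) + \<i> * of_real (sin (\<Delta> n)) * of_real (j k) + R n)
    \<longlonglongrightarrow> of_real (cos (\<xi> * h k)) + \<i> * of_real (sin (\<xi> * h k)) * of_real (j k) + 0"
    by (intro tendsto_intros R)
  then show ?thesis by (simp add: k'_def flip: eq)
qed

section \<open>The limit distribution\<close>

text \<open>The part of \<open>j\<close> that is not a multiple of \<open>h\<close> is odd under \<open>k \<mapsto> pi - k\<close>, which is why
  only \<open>\<Lambda>\<close> survives in the limit.\<close>

lemma h_minus: "h (- k) = - h k" and h_pi_minus: "h (pi - k) = h k"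
  and D_pi_minus: "D (pi - k) = D k"
  by (simp_all add: h_def D_def)

lemma j_fold: "j k + j (pi - k) = 2 * \<Lambda> * h k"
  by (simp add: j_def h_pi_minus D_pi_minus)

text \<open>The characteristic function of the limit law, written in the variable \<open>k\<close>
  with \<open>y = h k\<close>.\<close>

definition arc_integral :: "real \<Rightarrow> complex"
  where "arc_integral \<xi> =
    integral {- (pi/2)..pi/2} (\<lambda>k. (1 + \<Lambda> * h k) *\<^sub>R iexp (\<xi> * h k)) / of_real pi"

lemma arc_integral_eq:
  "integral {- (pi/2)..- (pi/2) + 2 * pi}
    (\<lambda>k. of_real (cos (\<xi> * h k)) + \<i> * of_real (sin (\<xi> * h k)) * of_real (j k))
    / of_real (2 * pi) = arc_integral \<xi>"
proof -
  let ?c = "\<lambda>k. complex_of_real (cos (\<xi> * h k))" and ?s = "\<lambda>k. complex_of_real (sin (\<xi> * h k))"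
  let ?even = "\<lambda>k. ?c k + \<i> * ?s k * of_real (\<Lambda> * h k)"
    and ?odd = "\<lambda>k. \<i> * ?s k + of_real (\<Lambda> * h k) * ?c k"
  have int: "?even integrable_on {x..y}" "?odd integrable_on {x..y}" for x y
    by (intro integrable_continuous_real continuous_intros)+
  let ?f = "\<lambda>k. ?c k + \<i> * ?s k * of_real (j k)"
  have "?f k + ?f (pi - k) = 2 * ?c k + \<i> * ?s k * of_real (j k + j (pi - k))" for k
    unfolding h_pi_minus of_real_add by (simp only: distrib_left) simp
  then have fold: "?f k + ?f (pi - k) = 2 * ?even k" for k
    unfolding j_fold by simp
  have "integral {- (pi/2)..- (pi/2) + 2 * pi} ?f = integral {- (pi/2)..pi/2} (\<lambda>k. ?f k + ?f (pi - k))"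
    by (intro integral_full_period_fold continuous_intros)
  also have "\<dots> = integral {- (pi/2)..pi/2} (\<lambda>k. 2 * ?even k)"
    unfolding fold ..
  also have "\<dots> = 2 * integral {- (pi/2)..pi/2} ?even"
    by (rule integral_mult_right)
  \<comment> \<open>\<open>?odd\<close> integrates to zero because \<open>h\<close> is odd; adding
    it completes the product \<open>(1 + \<Lambda> h) (cos + \<i> sin)\<close>.\<close>
  also have "integral {- (pi/2)..pi/2} ?even = integral {- (pi/2)..pi/2} ?even + integral {- (pi/2)..pi/2} ?odd"
    by (subst integral_odd[of ?odd]) (simp_all add: h_minus)
  also have "\<dots> = integral {- (pi/2)..pi/2} (\<lambda>k. ?even k + ?odd k)"
    by (rule Henstock_Kurzweil_Integration.integral_add[OF int, symmetric])
  also have "(\<lambda>k. ?even k + ?odd k) = (\<lambda>k. (1 + \<Lambda> * h k) *\<^sub>R iexp (\<xi> * h k))"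
    unfolding cis_conv_exp[symmetric] by (simp add: complex_eq_iff fun_eq_iff algebra_simps)
  finally show ?thesis by (simp add: arc_integral_def)
qed

text \<open>Under \<open>y = h k\<close> both factors in the denominator of the limit density become
  explicit, the square root included wherever \<open>cos k\<close> is nonnegative.\<close>

lemma h2: "s\<^sup>2 - (h k)\<^sup>2 = (s * t * cos k / D k)\<^sup>2"
  and one_minus_h2: "1 - (h k)\<^sup>2 = (t / D k)\<^sup>2"
proof -
  have "(D k)\<^sup>2 - (sin k)\<^sup>2 = (1 - s\<^sup>2) * (cos k)\<^sup>2"
    by (simp add: D2 sin_squared_eq algebra_simps)
  also have "1 - s\<^sup>2 = t\<^sup>2" using s2_t2 by simp
  finally have "s\<^sup>2 * ((D k)\<^sup>2 - (sin k)\<^sup>2) = s\<^sup>2 * (t\<^sup>2 * (cos k)\<^sup>2)" by simp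
  then show "s\<^sup>2 - (h k)\<^sup>2 = (s * t * cos k / D k)\<^sup>2"
    by (simp add: h_def power_divide power_mult_distrib field_simps)
  have "1 - (h k)\<^sup>2 = ((D k)\<^sup>2 - s\<^sup>2 * (sin k)\<^sup>2) / (D k)\<^sup>2"
    by (simp add: h_def power_divide power_mult_distrib diff_divide_distrib)
  also have "(D k)\<^sup>2 - s\<^sup>2 * (sin k)\<^sup>2 = t\<^sup>2" by (simp add: D2')
  finally show "1 - (h k)\<^sup>2 = (t / D k)\<^sup>2"
    by (simp add: power_divide)
qed

definition h' :: "real \<Rightarrow> real" where "h' k = s * t\<^sup>2 * cos k / (D k) ^ 3"

text \<open>The quotient rule leaves \<open>D^2 - s^2 sin^2\<close> in the numerator, which is the
  constant \<open>t^2\<close>.\<close>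

lemma has_real_derivative_h: "(h has_real_derivative h' k) (at k)"
proof -
  have pos: "0 < 1 - s\<^sup>2 * (cos k)\<^sup>2"
    using D2[of k] D_pos[of k] by (metis zero_less_power)
  have "((\<lambda>k. sqrt (1 - s\<^sup>2 * (cos k)\<^sup>2)) has_real_derivative s\<^sup>2 * cos k * sin k / D k) (at k)"
    using pos by (auto intro!: derivative_eq_intros simp: D_def field_simps)
  then have "(D has_real_derivative s\<^sup>2 * cos k * sin k / D k) (at k)"
    by (simp add: D_def[abs_def])
  moreover have "((\<lambda>k. s * sin k) has_real_derivative s * cos k) (at k)"
    by (auto intro!: derivative_eq_intros)
  ultimately have "((\<lambda>k. s * sin k / D k) has_real_derivative
    (s * cos k * D k - s * sin k * (s\<^sup>2 * cos k * sin k / D k)) / (D k * D k)) (at k)"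
    by (intro DERIV_divide) simp_all
  moreover have "s * cos k * D k - s * sin k * (s\<^sup>2 * cos k * sin k / D k) =
    s * cos k * ((D k)\<^sup>2 - s\<^sup>2 * (sin k)\<^sup>2) / D k"
    by (simp add: field_simps power2_eq_square)
  moreover have "(D k)\<^sup>2 - s\<^sup>2 * (sin k)\<^sup>2 = t\<^sup>2" by (simp add: D2')
  ultimately show ?thesis
    by (simp add: h_def[abs_def] h'_def power3_eq_cube mult_ac)
qed

lemma abs_h_le: "\<bar>h k\<bar> \<le> s"
proof -
  have "(h k)\<^sup>2 \<le> s\<^sup>2" using h2[of k] by (metis diff_ge_0_iff_ge zero_le_power2)
  then show ?thesis using s_pos by (simp add: abs_le_square_iff[symmetric])
qed

text \<open>Since \<open>j (pi/2) = \<Lambda> s\<close>, the bound is Cauchy-Schwarz for \<open>\<langle>(u, v), (p, q)\<rangle>\<close> at \<open>k = pi/2\<close>.\<close>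

lemma \<Lambda>_h_bound: "\<bar>\<Lambda> * h k\<bar> \<le> 1"
proof -
  have "cmod (\<i> * of_real (j (pi/2))) \<le> cmod (u (pi/2)) * cmod p + cmod (v (pi/2)) * cmod q"
    unfolding uv_pq[symmetric] by (rule order_trans[OF norm_triangle_ineq]) (simp add: norm_mult)
  also have "\<dots> \<le> ((cmod (u (pi/2)))\<^sup>2 + (cmod p)\<^sup>2) / 2 + ((cmod (v (pi/2)))\<^sup>2 + (cmod q)\<^sup>2) / 2"
    using sum_squares_bound[of "cmod (u (pi/2))" "cmod p"]
      sum_squares_bound[of "cmod (v (pi/2))" "cmod q"]
    by (intro add_mono) simp_all
  also have "\<dots> = 1"
    using norm_pq norm_uv_real[of "pi/2"] by (simp add: field_simps)
  finally have "\<bar>j (pi/2)\<bar> \<le> 1" by (simp add: norm_mult)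
  moreover have "j (pi/2) = \<Lambda> * s" by (simp add: j_def h_def D_def)
  ultimately have "\<bar>\<Lambda>\<bar> * s \<le> 1" using s_pos by (simp add: abs_mult)
  moreover have "\<bar>\<Lambda> * h k\<bar> \<le> \<bar>\<Lambda>\<bar> * s"
    unfolding abs_mult by (intro mult_left_mono abs_h_le) simp
  ultimately show ?thesis by linarith
qed

section \<open>The limit law as an image under \<open>h\<close>\<close>

definition limit_density :: "real \<Rightarrow> real"
  where "limit_density y = indicator {-s<..<s} y *
    (t * (1 + \<Lambda> * y) / (pi * (1 - y\<^sup>2) * sqrt (s\<^sup>2 - y\<^sup>2)))"

definition arc_density :: "real \<Rightarrow> real"
  where "arc_density k = indicator {- (pi/2)<..<pi/2} k * ((1 + \<Lambda> * h k) / pi)"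

text \<open>Ensures that \<open>ennreal\<close> truncates nothing when integrals against this
  density are unfolded.\<close>

lemma arc_density_nonneg: "0 \<le> arc_density k"
  using \<Lambda>_h_bound[of k] by (simp add: arc_density_def abs_le_iff)

text \<open>At the endpoints \<open>k = \<plusminus>pi/2\<close> both sides vanish, because \<open>h' k = 0\<close> there.\<close>

lemma limit_density_h:
  assumes "k \<in> {- (pi/2)..pi/2}"
  shows "limit_density (h k) * h' k = arc_density k"
proof (cases "k \<in> {- (pi/2)<..<pi/2}")
  case True
  then have cos: "0 < cos k" by (intro cos_gt_zero_pi) auto
  have "0 < (s * t * cos k / D k)\<^sup>2"
    using cos s_pos t_pos by simp
  then have "(h k)\<^sup>2 < s\<^sup>2" unfolding h2[symmetric] by simp
  then have "\<bar>h k\<bar> < s" using s_pos abs_le_square_iff[of s "h k"] by linarith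
  then have ind: "h k \<in> {-s<..<s}" by auto
  have "sqrt (s\<^sup>2 - (h k)\<^sup>2) = s * t * cos k / D k"
    unfolding h2 using cos s_pos t_pos D_pos[of k] by simp
  then have "limit_density (h k) = t * (1 + \<Lambda> * h k) / (pi * (t / D k)\<^sup>2 * (s * t * cos k / D k))"
    using ind by (simp add: limit_density_def one_minus_h2)
  moreover have "t * x / (pi * (t / D k)\<^sup>2 * (s * t * cos k / D k)) * h' k = x / pi" for x
    using cos s_pos t_pos by (simp add: h'_def field_simps power2_eq_square power3_eq_cube)
  ultimately show ?thesis using True by (simp add: arc_density_def)
next
  case False
  then have "k = - (pi/2) \<or> k = pi/2" using assms by auto
  then have "cos k = 0" by (metis cos_minus cos_pi_half)
  then show ?thesis using False by (simp add: h'_def arc_density_def)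
qed

lemma limit_density_measurable [measurable]: "limit_density \<in> borel_measurable borel"
  unfolding limit_density_def by measurable

lemma h_measurable [measurable]: "h \<in> borel_measurable borel"
  by (intro borel_measurable_continuous_onI continuous_intros)

lemma arc_density_measurable [measurable]: "arc_density \<in> borel_measurable borel"
  unfolding arc_density_def by measurable

text \<open>The substitution \<open>y = h k\<close>, where \<open>h\<close> increases from
  \<open>- s\<close> to \<open>s\<close>. Nonnegative integrals over Borel sets accommodate the
  singularities of the density at the two ends.\<close>

lemma limit_eq_distr:
  "density lborel (\<lambda>y. ennreal (limit_density y)) =
    distr (density lborel (\<lambda>k. ennreal (arc_density k))) borel h"
proof (rule measure_eqI)
  fix A assume "A \<in> sets (density lborel (\<lambda>y. ennreal (limit_density y)))"
  then have [measurable]: "A \<in> sets borel" by simp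
  define f where "f y = limit_density y * indicator A y" for y
  have [measurable]: "f \<in> borel_measurable borel" unfolding f_def by measurable
  have h_ends: "h (- (pi/2)) = - s" "h (pi/2) = s" by (simp_all add: h_def D_def)
  have h'_nonneg: "0 \<le> h' k" if "k \<in> {- (pi/2)..pi/2}" for k
    using that s_pos D_pos[of k] by (auto simp: h'_def intro!: divide_nonneg_nonneg mult_nonneg_nonneg cos_ge_zero)
  \<comment> \<open>The density vanishes outside the open interval from \<open>- s\<close> to
    \<open>s\<close>, so the added indicator changes nothing.\<close>
  have "emeasure (density lborel (\<lambda>y. ennreal (limit_density y))) A =
    (\<integral>\<^sup>+y. ennreal (f y * indicator {h (- (pi/2))..h (pi/2)} y) \<partial>lborel)"
    unfolding h_ends
    by (subst emeasure_density) (auto intro!: nn_integral_cong simp: f_def limit_density_def split: split_indicator)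
  also have "\<dots> = (\<integral>\<^sup>+k. ennreal (f (h k) * h' k * indicator {- (pi/2)..pi/2} k) \<partial>lborel)"
  proof (rule nn_integral_substitution)
    show "set_borel_measurable borel {h (- (pi/2))..h (pi/2)} f"
      unfolding set_borel_measurable_def by measurable
    show "continuous_on {- (pi/2)..pi/2} h'"
      unfolding h'_def by (intro continuous_intros) auto
  qed (use has_real_derivative_h h'_nonneg in auto)
  also have "\<dots> = (\<integral>\<^sup>+k. ennreal (arc_density k) * indicator (h -` A) k \<partial>lborel)"
  proof (rule nn_integral_cong)
    fix k
    have "f (h k) * h' k * indicator {- (pi/2)..pi/2} k = arc_density k * indicator (h -` A) k"
    proof (cases "k \<in> {- (pi/2)..pi/2}")
      case True
      then show ?thesis
        using limit_density_h[OF True] by (auto simp: f_def split: split_indicator)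
    qed (auto simp: arc_density_def)
    then show "ennreal (f (h k) * h' k * indicator {- (pi/2)..pi/2} k) =
      ennreal (arc_density k) * indicator (h -` A) k"
      by (auto split: split_indicator)
  qed
  also have "\<dots> = emeasure (distr (density lborel (\<lambda>k. ennreal (arc_density k))) borel h) A"
    by (subst emeasure_distr, simp, simp, subst emeasure_density)
       (auto intro: measurable_sets_borel[OF h_measurable])
  finally show "emeasure (density lborel (\<lambda>y. ennreal (limit_density y))) A =
    emeasure (distr (density lborel (\<lambda>k. ennreal (arc_density k))) borel h) A" .
qed simp

text \<open>Through \<open>limit_eq_distr\<close> the singular density gives way to a continuous
  integrand on a bounded interval, for which Lebesgue and gauge integrals agree.\<close>

lemma char_limit: "char (density lborel (\<lambda>y. ennreal (limit_density y))) \<xi> = arc_integral \<xi>"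
proof -
  let ?g = "\<lambda>k. (1 + \<Lambda> * h k) *\<^sub>R iexp (\<xi> * h k)"
  have "continuous_on UNIV ?g" by (intro continuous_intros)
  then have "set_integrable lborel {- (pi/2)..pi/2} ?g"
    by (intro borel_integrable_atLeastAtMost') (auto intro: continuous_on_subset)
  then have g: "set_integrable lborel {- (pi/2)<..<pi/2} ?g"
    by (rule set_integrable_subset) auto
  have "char (density lborel (\<lambda>y. ennreal (limit_density y))) \<xi> =
    (\<integral>k. arc_density k *\<^sub>R iexp (\<xi> * h k) \<partial>lborel)"
    unfolding char_def limit_eq_distr
    by (subst integral_distr, simp, measurable, subst integral_density) (auto simp: arc_density_nonneg)
  also have "\<dots> = (LINT k:{- (pi/2)<..<pi/2}|lborel. ?g k / of_real pi)"
    unfolding set_lebesgue_integral_def arc_density_def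
    by (intro Bochner_Integration.integral_cong refl) (simp add: scaleR_conv_of_real)
  also have "\<dots> = (LINT k:{- (pi/2)<..<pi/2}|lborel. ?g k) / of_real pi"
    by (rule set_integral_divide_zero)
  also have "\<dots> = arc_integral \<xi>"
    unfolding arc_integral_def set_borel_integral_eq_integral(2)[OF g] integral_open_interval_real ..
  finally show ?thesis .
qed

text \<open>Gives the total mass of the limit law: \<open>\<Lambda> * h\<close> is odd, and the
  interval has length \<open>pi\<close>.\<close>

lemma arc_integral_0: "arc_integral 0 = 1"
proof -
  have "integral {- (pi/2)..pi/2} (\<lambda>k. (1 + \<Lambda> * h k) *\<^sub>R iexp (0 * h k)) =
    integral {- (pi/2)..pi/2} (\<lambda>k. 1 + of_real (\<Lambda> * h k))"
    by (simp add: scaleR_conv_of_real)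
  also have "\<dots> = integral {- (pi/2)..pi/2} (\<lambda>k. 1) +
      integral {- (pi/2)..pi/2} (\<lambda>k. complex_of_real (\<Lambda> * h k))"
    by (intro Henstock_Kurzweil_Integration.integral_add integrable_continuous_real continuous_intros)
  also have "integral {- (pi/2)..pi/2} (\<lambda>k. complex_of_real (\<Lambda> * h k)) = 0"
    by (rule integral_odd) (simp add: h_minus)
  finally show ?thesis by (simp add: arc_integral_def scaleR_conv_of_real)
qed

lemma real_distribution_limit: "real_distribution (density lborel (\<lambda>y. ennreal (limit_density y)))"
proof -
  let ?N = "density lborel (\<lambda>y. ennreal (limit_density y))"
  have "char ?N 0 = of_real (measure ?N UNIV)"
    by (simp add: char_def scaleR_conv_of_real)
  then have "measure ?N UNIV = 1" using char_limit[of 0] by (simp add: arc_integral_0)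
  \<comment> \<open>\<open>measure\<close> sends infinite mass to 0, so the value 1 excludes
    it.\<close>
  moreover from this have "emeasure ?N UNIV \<noteq> \<top>" by (auto simp: measure_def)
  ultimately have "emeasure ?N (space ?N) = 1"
    by (simp add: emeasure_eq_ennreal_measure)
  then have "prob_space ?N" by (rule prob_spaceI)
  then show ?thesis by (simp add: real_distribution_def real_distribution_axioms_def)
qed

end

section \<open>Convergence of the walk\<close>

text \<open>The walk detached from the Hilbert space: \<open>a n x\<close> and \<open>b n x\<close>
  stand for the coefficients of the state at time \<open>n\<close> along \<open>e1\<close> and
  \<open>e2\<close> at \<open>x\<close>.\<close>

locale walk = coin +
  fixes a b :: "nat \<Rightarrow> int \<Rightarrow> complex"
  assumes a_0: "a 0 x = (if x = 0 then p else 0)" and b_0: "b 0 x = (if x = 0 then q else 0)"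
    and a_Suc: "a (Suc n) x = of_real s * a n (x - 1) - of_real t * b n (x + 1)"
    and b_Suc: "b (Suc n) x = of_real t * a n (x - 1) + of_real s * b n (x + 1)"
begin

definition P :: "nat \<Rightarrow> int \<Rightarrow> real"
  where "P n x = (cmod (a n x))\<^sup>2 + (cmod (b n x))\<^sup>2"

lemma support: "\<bar>x\<bar> > int n \<Longrightarrow> a n x = 0 \<and> b n x = 0"
proof (induction n arbitrary: x)
  case (Suc n)
  then show ?case by (simp add: a_Suc b_Suc)
qed (simp add: a_0 b_0)

lemma P_nonneg: "0 \<le> P n x"
  by (simp add: P_def)

lemma P_support: "\<bar>x\<bar> > int n \<Longrightarrow> P n x = 0"
  by (simp add: P_def support)

text \<open>The translations in the recursion turn into multiplication by \<open>cis k\<close> and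
  \<open>cnj (cis k)\<close>, which yields the recursion of \<open>amp_Suc\<close>.\<close>

lemma fourier_transform:
  "(\<Sum>x\<in>{- int n..int n}. a n x * cis (of_int x * k)) = ampA n k"
  "(\<Sum>x\<in>{- int n..int n}. b n x * cis (of_int x * k)) = ampB n k"
proof (induction n)
  case 0
  { case 1 show ?case by (simp add: a_0 ampA_def) }
  { case 2 show ?case by (simp add: b_0 ampB_def) }
next
  case (Suc n)
  define A B where "A = (\<lambda>x. a n x * cis (of_int x * k))" and "B = (\<lambda>x. b n x * cis (of_int x * k))"
  have A: "(\<Sum>x\<in>{- int (Suc n)..int (Suc n)}. A (x + -1)) = ampA n k"
    using sum_shift_supported[of "int n" A "-1" 1] support[of n] Suc.IH(1) by (simp add: A_def add.commute)
  have B: "(\<Sum>x\<in>{- int (Suc n)..int (Suc n)}. B (x + 1)) = ampB n k"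
    using sum_shift_supported[of "int n" B 1 1] support[of n] Suc.IH(2) by (simp add: B_def add.commute)
  have cA: "cis (of_int x * k) = cis k * cis (of_int (x - 1) * k)" for x
    by (simp add: cis_mult algebra_simps)
  have cB: "cis (of_int x * k) = cnj (cis k) * cis (of_int (x + 1) * k)" for x
    by (simp add: cis_cnj cis_mult algebra_simps)
  have sA: "c * a n (x - 1) * cis (of_int x * k) = c * cis k * A (x + -1)"
    for c x unfolding A_def cA[of x] by simp
  have sB: "c * b n (x + 1) * cis (of_int x * k) = c * cnj (cis k) * B (x + 1)"
    for c x unfolding B_def cB[of x] by simp
  have "a (Suc n) x * cis (of_int x * k) =
    of_real s * cis k * A (x + -1) - of_real t * cnj (cis k) * B (x + 1)"
    "b (Suc n) x * cis (of_int x * k) =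
    of_real t * cis k * A (x + -1) + of_real s * cnj (cis k) * B (x + 1)" for x
    unfolding a_Suc b_Suc distrib_right left_diff_distrib sA sB by (rule refl)+
  then show "(\<Sum>x\<in>{- int (Suc n)..int (Suc n)}. a (Suc n) x * cis (of_int x * k)) = ampA (Suc n) k"
    "(\<Sum>x\<in>{- int (Suc n)..int (Suc n)}. b (Suc n) x * cis (of_int x * k)) = ampB (Suc n) k"
    unfolding amp_Suc A[symmetric] B[symmetric]
    by (simp_all only: sum.distrib sum_subtractf sum_distrib_left)
qed

text \<open>The coin rotates the pair \<open>a n (x - 1)\<close>, \<open>b n (x + 1)\<close> that
  arrives at \<open>x\<close>, so a step only translates the two families of squared moduli.\<close>

lemma sum_P: "(\<Sum>x\<in>{- int n..int n}. P n x) = 1"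
proof (induction n)
  case 0
  then show ?case using norm_pq by (simp add: P_def a_0 b_0)
next
  case (Suc n)
  define A B where "A = (\<lambda>x. (cmod (a n x))\<^sup>2)" and "B = (\<lambda>x. (cmod (b n x))\<^sup>2)"
  have iso: "(cmod (of_real s * y - of_real t * z))\<^sup>2 + (cmod (of_real t * y + of_real s * z))\<^sup>2
    = (cmod y)\<^sup>2 + (cmod z)\<^sup>2" for y z
  proof -
    have "(cmod (of_real s * y - of_real t * z))\<^sup>2 + (cmod (of_real t * y + of_real s * z))\<^sup>2
      = (s\<^sup>2 + t\<^sup>2) * ((cmod y)\<^sup>2 + (cmod z)\<^sup>2)"
      unfolding cmod_power2 by (simp add: power2_eq_square algebra_simps)
    then show ?thesis by (simp add: s2_t2)
  qed
  have "(\<Sum>x\<in>{- int (Suc n)..int (Suc n)}. P (Suc n) x) =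
    (\<Sum>x\<in>{- int (Suc n)..int (Suc n)}. A (x + -1)) + (\<Sum>x\<in>{- int (Suc n)..int (Suc n)}. B (x + 1))"
    unfolding P_def a_Suc b_Suc iso sum.distrib by (simp add: A_def B_def)
  also have "\<dots> = (\<Sum>x\<in>{- int n..int n}. A x) + (\<Sum>x\<in>{- int n..int n}. B x)"
    using sum_shift_supported[of "int n" A "-1" 1] sum_shift_supported[of "int n" B 1 1]
      support[of n]
    by (simp add: A_def B_def add.commute)
  also have "\<dots> = 1"
    using Suc.IH by (simp add: P_def A_def B_def sum.distrib)
  finally show ?case .
qed

lemma real_distribution_scaled: "real_distribution (scaled_measure (P n) n)"
proof -
  have "(\<integral>\<^sup>+x. ennreal (P n x) \<partial>count_space UNIV) = (\<Sum>x\<in>{- int n..int n}. ennreal (P n x))"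
    by (rule nn_integral_count_space') (auto simp: P_support)
  also have "\<dots> = 1"
    using sum_P[of n] by (simp add: sum_ennreal P_nonneg)
  finally have "prob_space (density (count_space UNIV) (\<lambda>x. ennreal (P n x)))"
    by (intro prob_spaceI) (simp add: emeasure_density)
  then have "prob_space (scaled_measure (P n) n)"
    unfolding scaled_measure_def by (rule prob_space.prob_space_distr) simp
  then show ?thesis
    by (simp add: real_distribution_def real_distribution_axioms_def scaled_measure_def)
qed

text \<open>Parseval with shift \<open>\<xi> / n\<close> for both components. The case
  \<open>n = 0\<close> fits, as \<open>\<xi> / 0 = 0\<close> and all mass then sits at 0.\<close>

lemma char_scaled:
  "char (scaled_measure (P n) n) \<xi> =
    integral {c..c + 2 * pi}
      (\<lambda>k. ampA n (k + \<xi> / n) * cnj (ampA n k) + ampB n (k + \<xi> / n) * cnj (ampB n k))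
      / of_real (2 * pi)"
proof -
  let ?I = "{- int n..int n}"
  have "((\<lambda>k. ampA n (k + \<xi> / n) * cnj (ampA n k) + ampB n (k + \<xi> / n) * cnj (ampB n k)) has_integral
    2 * pi * (\<Sum>x\<in>?I. of_real ((cmod (a n x))\<^sup>2) * cis (of_int x * (\<xi> / n))) +
    2 * pi * (\<Sum>x\<in>?I. of_real ((cmod (b n x))\<^sup>2) * cis (of_int x * (\<xi> / n)))) {c..c + 2 * pi}"
    unfolding fourier_transform[symmetric]
    by (intro has_integral_add has_integral_trig_poly_mult_cnj) auto
  also have "2 * pi * (\<Sum>x\<in>?I. of_real ((cmod (a n x))\<^sup>2) * cis (of_int x * (\<xi> / n))) +
    2 * pi * (\<Sum>x\<in>?I. of_real ((cmod (b n x))\<^sup>2) * cis (of_int x * (\<xi> / n))) =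
    of_real (2 * pi) * (\<Sum>x\<in>?I. of_real (P n x) * cis (of_int x * (\<xi> / n)))"
    by (simp add: P_def distrib_right sum.distrib distrib_left)
  also have "(\<Sum>x\<in>?I. of_real (P n x) * cis (of_int x * (\<xi> / n))) =
    (\<integral>x. of_real (P n x) * cis (of_int x * (\<xi> / n)) \<partial>count_space UNIV)"
  proof (subst lebesgue_integral_count_space_finite_support)
    have sub: "{x \<in> UNIV. of_real (P n x) * cis (of_int x * (\<xi> / n)) \<noteq> 0} \<subseteq> ?I"
      using P_support[of n] by (auto simp: not_less[symmetric])
    then show "finite {x \<in> UNIV. of_real (P n x) * cis (of_int x * (\<xi> / n)) \<noteq> 0}"
      by (rule finite_subset) simp
    show "(\<Sum>x\<in>?I. of_real (P n x) * cis (of_int x * (\<xi> / n))) =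
      (\<Sum>x | x \<in> UNIV \<and> of_real (P n x) * cis (of_int x * (\<xi> / n)) \<noteq> 0.
        of_real (P n x) * cis (of_int x * (\<xi> / n)))"
      using sub by (intro sum.mono_neutral_right) auto
  qed
  also have "\<dots> = char (scaled_measure (P n) n) \<xi>"
    unfolding char_def scaled_measure_def
  proof -
    have *: "of_real (P n x) * cis (of_int x * (\<xi> / n)) = P n x *\<^sub>R iexp (\<xi> * (of_int x / n))" for x
      unfolding scaleR_conv_of_real cis_conv_exp by (simp add: mult.commute)
    show "(\<integral>x. of_real (P n x) * cis (of_int x * (\<xi> / n)) \<partial>count_space UNIV) =
      (CLINT x | distr (density (count_space UNIV) (\<lambda>x. ennreal (P n x))) borel
        (\<lambda>x. real_of_int x / real n). iexp (\<xi> * x))"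
      unfolding * by (subst integral_distr, simp, simp, subst integral_density) (simp_all add: P_nonneg)
  qed
  finally show ?thesis
    by (simp add: integral_unique)
qed

lemma weakly_converges_scaled:
  "weakly_converges (\<lambda>n. scaled_measure (P n) n) (density lborel (\<lambda>y. ennreal (limit_density y)))"
  (is "weakly_converges ?M ?N")
proof -
  let ?I = "{- (pi/2)..- (pi/2) + 2 * pi}"
  let ?G = "\<lambda>\<xi> n k. ampA n (k + \<xi> / real n) * cnj (ampA n k)
    + ampB n (k + \<xi> / real n) * cnj (ampB n k)"
  let ?g = "\<lambda>\<xi> k. complex_of_real (cos (\<xi> * h k)) + \<i> * of_real (sin (\<xi> * h k)) * of_real (j k)"
  have bound: "cmod (?G \<xi> n k) \<le> 8" for \<xi> n k
  proof -
    have "cmod (?G \<xi> n k) \<le> cmod (ampA n (k + \<xi> / real n)) * cmod (ampA n k)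
      + cmod (ampB n (k + \<xi> / real n)) * cmod (ampB n k)"
      by (rule order_trans[OF norm_triangle_ineq]) (simp add: norm_mult)
    also have "\<dots> \<le> 2 * 2 + 2 * 2"
      by (intro add_mono mult_mono amp_bound) auto
    finally show ?thesis by simp
  qed
  have "(\<lambda>n. char (?M n) \<xi>) \<longlonglongrightarrow> char ?N \<xi>" for \<xi>
  proof -
    have "(\<lambda>n. integral ?I (?G \<xi> n)) \<longlonglongrightarrow> integral ?I (?g \<xi>)"
    proof (rule dominated_convergence(2))
      show "?G \<xi> n integrable_on ?I" for n
        by (intro integrable_continuous_real continuous_intros)
      show "(\<lambda>_. 8 :: real) integrable_on ?I"
        by (intro integrable_continuous_real continuous_intros)
    qed (use bound amp_product_tendsto in auto)
    then have "(\<lambda>n. integral ?I (?G \<xi> n) / of_real (2 * pi)) \<longlonglongrightarrow> integral ?I (?g \<xi>) / of_real (2 * pi)"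
      by (intro tendsto_divide tendsto_const) simp_all
    then show ?thesis
      unfolding char_scaled[where c = "- (pi/2)"] char_limit arc_integral_eq .
  qed
  \<comment> \<open>Levy's theorem gives convergence of distribution functions, which is then
    transferred to bounded continuous test functions.\<close>
  then have weak: "weak_conv_m ?M ?N"
    by (intro levy_continuity real_distribution_scaled real_distribution_limit)
  show ?thesis
    unfolding weakly_converges_def
  proof (intro conjI allI impI real_distribution_scaled real_distribution_limit)
    fix f :: "real \<Rightarrow> real" assume f: "continuous_on UNIV f \<and> bounded (range f)"
    then obtain B where B: "norm (f x) \<le> B" for x by (auto simp: bounded_iff)
    show "(\<lambda>n. \<integral>x. f x \<partial>?M n) \<longlonglongrightarrow> (\<integral>x. f x \<partial>?N)"
      using f B
      by (intro weak_conv_imp_integral_bdd_continuous_conv[OF real_distribution_scaled real_distribution_limit weak])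
         (auto simp: continuous_on_eq_continuous_at)
  qed
qed

end

theorem theorem5:
  fixes V W \<sigma> :: "'a::chilbert_space \<Rightarrow> 'a"
    and e :: 'a
    and \<psi> :: "complex^2"
    and s t :: real
  assumes "unitary V" and "unitary W" and "unitary \<sigma>"
    and "QW1 W" and "QW2 V W" and "QW3 V W \<sigma>" and "QW4 \<sigma>"
    and "QWR V \<sigma> e"
    and "norm \<psi> = 1"
    and "0 < s" and "s < 1" and "0 < t" and "t < 1" and "s\<^sup>2 + t\<^sup>2 = 1"
  shows "weakly_converges
    (\<lambda>n. scaled_measure (walk_prob V W \<sigma> e s t \<psi> n) n)
    (limit_measure \<psi> s t)"
proof -
  interpret qwalk V W \<sigma> e
    using assms by unfold_locales
  have "(cmod (\<psi> $ 1))\<^sup>2 + (cmod (\<psi> $ 2))\<^sup>2 = 1"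
    using \<open>norm \<psi> = 1\<close> by (simp add: norm_vec_def L2_set_def sum_2)
  \<comment> \<open>The matrix elements computed in \<open>qwalk\<close> are exactly the initial
    values and the recursion required here.\<close>
  then interpret walk s t "\<psi> $ 1" "\<psi> $ 2"
    "\<lambda>n x. cinner ((U_op s t V W ^^ n) (init_state V W \<sigma> e \<psi>)) (e1 V \<sigma> e x)"
    "\<lambda>n x. cinner ((U_op s t V W ^^ n) (init_state V W \<sigma> e \<psi>)) (e2 V W \<sigma> e x)"
    using assms by unfold_locales (simp_all add: cinner_init_e1 cinner_init_e2 cinner_U_e1 cinner_U_e2)
  have "walk_prob V W \<sigma> e s t \<psi> = P"
    by (simp add: fun_eq_iff walk_prob_def P_def)
  moreover have "limit_measure \<psi> s t = density lborel (\<lambda>y. ennreal (limit_density y))"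
    by (simp add: limit_measure_def limit_density_def[abs_def] lam_def \<Lambda>_def)
  ultimately show ?thesis
    using weakly_converges_scaled by simp
qed

end
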